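(* Let $\mathcal C$ be a connected small category. Pick any $v\in\mathcal C^0$ and set $S=\mathcal C^0\setminus\{v\}$. Then $$U(\mathcal C)\simeq\mathbb F(S)*\pi(\mathcal C),$$ where $U(\mathcal C)$ is the universal group of $\mathcal C$, $\mathbb F(S)$ is the free group on the set $S$, $\pi(\mathcal C)$ is the fundamental group of $\mathcal C$, and $*$ denotes the free product of groups.
   Context: A small category $\mathcal C$ is identified with its set of morphisms, objects (vertices) being identified with identity morphisms and forming $\mathcal C^0\subseteq\mathcal C$; for $v,w\in\mathcal C^0$, $v\mathcal C w$ is the set of morphisms with range $v$ and source $w$. $\mathcal C$ is connected if the equivalence relation on $\mathcal C^0$ generated by $\{(v,w):v\mathcal C w\neq\varnothing\}$ is all of $\mathcal C^0\times\mathcal C^0$. A cocycle on $\mathcal C$ is a functor from $\mathcal C$ into a group. A universal group of $\mathcal C$ is a pair $(U,j)$, with $j:\mathcal C\to U$ a cocycle into a group $U$, such that for every cocycle $\psi:\mathcal C\to H$ into a group $H$ there is a unique group homomorphism $\psi':U\to H$ with $\psi=\psi'\circ j$. Every small category has a universal group, unique up to unique isomorphism, denoted $U(\mathcal C)$. A fundamental groupoid of $\mathcal C$ is a pair $(\mathcal G(\mathcal C),i)$, with $i:\mathcal C\to\mathcal G(\mathcal C)$ a functor into a groupoid, such that every functor from $\mathcal C$ to a groupoid factors uniquely through $i$ via a groupoid morphism. It exists, is unique up to unique isomorphism, and $i$ maps $\mathcal C^0$ bijectively onto $\mathcal G(\mathcal C)^0$, so these are identified. For connected $\mathcal C$, the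 fundamental group at $v\in\mathcal C^0$ is $\pi(\mathcal C,v)=v\,\mathcal G(\mathcal C)\,v$; these groups are all isomorphic and $\pi(\mathcal C)$ denotes any of them. *)

theory Defs
  imports "HOL-Algebra.Group"
begin

section \<open>Small categories and groupoids\<close>

text \<open>
  A small category is given by its set of morphisms; the objects are the identity morphisms.
  The composite \<open>comp C x y\<close> is meaningful when \<open>src C x = rng C y\<close>.
\<close>

record 'm category =
  mor  :: "'m set"
  rng  :: "'m \<Rightarrow> 'm"
  src  :: "'m \<Rightarrow> 'm"
  comp :: "'m \<Rightarrow> 'm \<Rightarrow> 'm"

definition obj :: "'m category \<Rightarrow> 'm set" where
  "obj C = {v \<in> mor C. rng C v = v \<and> src C v = v}"

locale small_category =
  fixes C :: "'m category"
  assumes rng_obj: "x \<in> mor C \<Longrightarrow> rng C x \<in> obj C"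
    and src_obj: "x \<in> mor C \<Longrightarrow> src C x \<in> obj C"
    and comp_mor: "\<lbrakk>x \<in> mor C; y \<in> mor C; src C x = rng C y\<rbrakk> \<Longrightarrow> comp C x y \<in> mor C"
    and rng_comp: "\<lbrakk>x \<in> mor C; y \<in> mor C; src C x = rng C y\<rbrakk> \<Longrightarrow> rng C (comp C x y) = rng C x"
    and src_comp: "\<lbrakk>x \<in> mor C; y \<in> mor C; src C x = rng C y\<rbrakk> \<Longrightarrow> src C (comp C x y) = src C y"
    and rng_left_id: "x \<in> mor C \<Longrightarrow> comp C (rng C x) x = x"
    and src_right_id: "x \<in> mor C \<Longrightarrow> comp C x (src C x) = x"
    and comp_assoc: "\<lbrakk>x \<in> mor C; y \<in> mor C; z \<in> mor C; src C x = rng C y; src C y = rng C z\<rbrakk>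
      \<Longrightarrow> comp C (comp C x y) z = comp C x (comp C y z)"

locale groupoid = small_category +
  assumes invertible: "x \<in> mor C \<Longrightarrow> \<exists>y \<in> mor C. src C y = rng C x \<and> rng C y = src C x
      \<and> comp C x y = rng C x \<and> comp C y x = src C x"

definition homset :: "'m category \<Rightarrow> 'm \<Rightarrow> 'm \<Rightarrow> 'm set" where
  "homset C v w = {x \<in> mor C. rng C x = v \<and> src C x = w}"

definition connected_category :: "'m category \<Rightarrow> bool" where
  "connected_category C \<longleftrightarrow>
     \<Inter>{E. equiv (obj C) E \<and> {(v, w) \<in> obj C \<times> obj C. homset C v w \<noteq> {}} \<subseteq> E}
       = obj C \<times> obj C"

definition is_functor :: "'m category \<Rightarrow> 'n category \<Rightarrow> ('m \<Rightarrow> 'n) \<Rightarrow> bool" where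
  "is_functor C D F \<longleftrightarrow>
     (\<forall>x \<in> mor C. F x \<in> mor D \<and> F (rng C x) = rng D (F x) \<and> F (src C x) = src D (F x)) \<and>
     (\<forall>x \<in> mor C. \<forall>y \<in> mor C. src C x = rng C y \<longrightarrow> F (comp C x y) = comp D (F x) (F y))"

definition isotropy_group :: "'g category \<Rightarrow> 'g \<Rightarrow> 'g monoid" where
  "isotropy_group G u = \<lparr>carrier = homset G u u, mult = comp G, one = u\<rparr>"

definition group_category :: "'h monoid \<Rightarrow> 'h category" where
  "group_category H =
     \<lparr>mor = carrier H, rng = (\<lambda>_. \<one>\<^bsub>H\<^esub>), src = (\<lambda>_. \<one>\<^bsub>H\<^esub>), comp = mult H\<rparr>"

definition cocycle :: "'m category \<Rightarrow> 'h monoid \<Rightarrow> ('m \<Rightarrow> 'h) \<Rightarrow> bool" where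
  "cocycle C H \<psi> \<longleftrightarrow> is_functor C (group_category H) \<psi>"


section \<open>Universal group and fundamental groupoid\<close>

text \<open>
  HOL cannot quantify over all types inside a formula, so the test objects of the universal
  properties are those whose elements have a given type \<open>'h\<close>.  The factoring maps are
  normalised outside the carrier by \<^const>\<open>extensional\<close>, so that uniqueness means uniqueness
  on the carrier.
\<close>

definition universal_group ::
    "'h itself \<Rightarrow> 'm category \<Rightarrow> 'u monoid \<Rightarrow> ('m \<Rightarrow> 'u) \<Rightarrow> bool" where
  "universal_group (t :: 'h itself) C U j \<longleftrightarrow>
     group U \<and> cocycle C U j \<and>
     (\<forall>(H :: 'h monoid) \<psi>. group H \<and> cocycle C H \<psi> \<longrightarrow>
        (\<exists>!\<psi>'. \<psi>' \<in> extensional (carrier U) \<and> \<psi>' \<in> hom U H \<and>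
               (\<forall>x \<in> mor C. \<psi> x = \<psi>' (j x))))"

definition fundamental_groupoid ::
    "'h itself \<Rightarrow> 'm category \<Rightarrow> 'g category \<Rightarrow> ('m \<Rightarrow> 'g) \<Rightarrow> bool" where
  "fundamental_groupoid (t :: 'h itself) C G i \<longleftrightarrow>
     groupoid G \<and> is_functor C G i \<and>
     (\<forall>(K :: 'h category) F. groupoid K \<and> is_functor C K F \<longrightarrow>
        (\<exists>!F'. F' \<in> extensional (mor G) \<and> is_functor G K F' \<and>
               (\<forall>x \<in> mor C. F x = F' (i x))))"

text \<open>
  A type large enough to test both universal properties: it is infinite, and it has room for
  copies of the category (type \<open>'m\<close>), its universal group (type \<open>'u\<close>), its fundamental
  groupoid (type \<open>'g\<close>), and all free groups and free products built from them.  A universal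
  property for test objects of all types implies the one for test objects of this type, so
  assuming only the latter is no restriction.
\<close>

type_synonym ('m, 'u, 'g) universe = "('m + 'u + 'g) list"


section \<open>Free groups and free products\<close>

inductive_set word_cong :: "'a set \<Rightarrow> ('a list \<times> 'a list) set \<Rightarrow> ('a list \<times> 'a list) set"
  for A R where
  step: "\<lbrakk>(p, q) \<in> R; p \<in> lists A; q \<in> lists A; x \<in> lists A; y \<in> lists A\<rbrakk>
     \<Longrightarrow> (x @ p @ y, x @ q @ y) \<in> word_cong A R"
| refl: "x \<in> lists A \<Longrightarrow> (x, x) \<in> word_cong A R"
| sym: "(x, y) \<in> word_cong A R \<Longrightarrow> (y, x) \<in> word_cong A R"
| trans: "\<lbrakk>(x, y) \<in> word_cong A R; (y, z) \<in> word_cong A R\<rbrakk> \<Longrightarrow> (x, z) \<in> word_cong A R"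

definition presented_monoid :: "'a set \<Rightarrow> ('a list \<times> 'a list) set \<Rightarrow> 'a list set monoid" where
  "presented_monoid A R =
     \<lparr>carrier = lists A // word_cong A R,
      mult = (\<lambda>X Y. \<Union>x \<in> X. \<Union>y \<in> Y. word_cong A R `` {x @ y}),
      one = word_cong A R `` {[]}\<rparr>"

text \<open>The letter \<open>(s, True)\<close> stands for the generator \<open>s\<close>, and \<open>(s, False)\<close> for its inverse.\<close>

definition free_group_rel :: "'s set \<Rightarrow> (('s \<times> bool) list \<times> ('s \<times> bool) list) set" where
  "free_group_rel S = {([(s, b), (s, \<not> b)], []) |s b. s \<in> S}"

definition free_group :: "'s set \<Rightarrow> ('s \<times> bool) list set monoid" where
  "free_group S = presented_monoid (S \<times> UNIV) (free_group_rel S)"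

definition free_product_rel :: "'a monoid \<Rightarrow> 'b monoid \<Rightarrow> (('a + 'b) list \<times> ('a + 'b) list) set" where
  "free_product_rel G H =
      {([Inl a, Inl b], [Inl (a \<otimes>\<^bsub>G\<^esub> b)]) |a b. a \<in> carrier G \<and> b \<in> carrier G} \<union>
      {([Inr a, Inr b], [Inr (a \<otimes>\<^bsub>H\<^esub> b)]) |a b. a \<in> carrier H \<and> b \<in> carrier H} \<union>
      {([Inl \<one>\<^bsub>G\<^esub>], []), ([Inr \<one>\<^bsub>H\<^esub>], [])}"

definition free_product :: "'a monoid \<Rightarrow> 'b monoid \<Rightarrow> ('a + 'b) list set monoid" where
  "free_product G H = presented_monoid (carrier G <+> carrier H) (free_product_rel G H)"


subsection \<open>Groups and universal properties\<close>

lemma word_cong_lists: "(x, y) \<in> word_cong A R \<Longrightarrow> x \<in> lists A \<and> y \<in> lists A"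
  by (induction rule: word_cong.induct) auto

lemma equiv_word_cong: "equiv (lists A) (word_cong A R)"
proof (rule equivI)
  show "word_cong A R \<subseteq> lists A \<times> lists A"
    by (auto simp del: in_lists_conv_set dest!: word_cong_lists)
  show "refl_on (lists A) (word_cong A R)"
    by (rule refl_onI) (auto intro: word_cong.refl)
  show "sym (word_cong A R)" by (rule symI) (rule word_cong.sym)
  show "trans (word_cong A R)" by (rule transI) (rule word_cong.trans)
qed

lemma word_cong_context:
  "(x, y) \<in> word_cong A R \<Longrightarrow> u \<in> lists A \<Longrightarrow> w \<in> lists A
     \<Longrightarrow> (u @ x @ w, u @ y @ w) \<in> word_cong A R"
proof (induction rule: word_cong.induct)
  case (step p q x y)
  then show ?case using word_cong.step[of p q R A "u @ x" "y @ w"] by simp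
next
  case (refl x)
  then show ?case by (intro word_cong.refl) (simp add: in_lists_conv_set ball_Un)
qed (blast intro: word_cong.sym word_cong.trans)+

lemma word_cong_rel:
  "\<lbrakk>(p, q) \<in> R; p \<in> lists A; q \<in> lists A\<rbrakk> \<Longrightarrow> (p, q) \<in> word_cong A R"
  using word_cong.step[of p q R A "[]" "[]"] by simp

lemma word_cong_append:
  assumes "(x, x') \<in> word_cong A R" "(y, y') \<in> word_cong A R"
  shows "(x @ y, x' @ y') \<in> word_cong A R"
proof (rule word_cong.trans)
  note l = word_cong_lists[OF assms(1)] word_cong_lists[OF assms(2)]
  show "(x @ y, x' @ y) \<in> word_cong A R"
    using word_cong_context[OF assms(1), of "[]" y] l by simp
  show "(x' @ y, x' @ y') \<in> word_cong A R"
    using word_cong_context[OF assms(2), of x' "[]"] l by simp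
qed

lemma presented_mult:
  assumes "x \<in> lists A" "y \<in> lists A"
  shows "(word_cong A R `` {x}) \<otimes>\<^bsub>presented_monoid A R\<^esub> (word_cong A R `` {y})
           = word_cong A R `` {x @ y}"
proof -
  have *: "word_cong A R `` {x' @ y'} = word_cong A R `` {x @ y}"
    if "(x, x') \<in> word_cong A R" "(y, y') \<in> word_cong A R" for x' y'
    using equiv_class_eq[OF equiv_word_cong word_cong_append[OF that]] by simp
  have "(\<Union>x' \<in> word_cong A R `` {x}. \<Union>y' \<in> word_cong A R `` {y}. word_cong A R `` {x' @ y'})
      = (\<Union>x' \<in> word_cong A R `` {x}. \<Union>y' \<in> word_cong A R `` {y}. word_cong A R `` {x @ y})"
    by (intro SUP_cong HOL.refl *) (simp_all only: Image_singleton_iff)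
  also have "\<dots> = word_cong A R `` {x @ y}"
    using word_cong.refl[OF assms(1), of R] word_cong.refl[OF assms(2), of R] by blast
  finally show ?thesis
    by (simp only: presented_monoid_def monoid.simps)
qed

lemma presented_carrierE:
  assumes "X \<in> carrier (presented_monoid A R)"
  obtains x where "x \<in> lists A" "X = word_cong A R `` {x}"
  using assms that by (auto simp: presented_monoid_def elim!: quotientE)

lemma presented_carrierI:
  "x \<in> lists A \<Longrightarrow> word_cong A R `` {x} \<in> carrier (presented_monoid A R)"
  by (simp add: presented_monoid_def quotientI)

lemma presented_one: "\<one>\<^bsub>presented_monoid A R\<^esub> = word_cong A R `` {[]}"
  by (simp add: presented_monoid_def)

lemma presented_is_monoid: "monoid (presented_monoid A R)"
proof
  fix X Y Z
  assume "X \<in> carrier (presented_monoid A R)" "Y \<in> carrier (presented_monoid A R)"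
  then obtain x y where x: "x \<in> lists A" "X = word_cong A R `` {x}"
    and y: "y \<in> lists A" "Y = word_cong A R `` {y}"
    by (metis presented_carrierE)
  then have xy: "x @ y \<in> lists A" by simp
  show "X \<otimes>\<^bsub>presented_monoid A R\<^esub> Y \<in> carrier (presented_monoid A R)"
    unfolding x y presented_mult[OF x(1) y(1)] by (rule presented_carrierI[OF xy])
  assume "Z \<in> carrier (presented_monoid A R)"
  then obtain z where z: "z \<in> lists A" "Z = word_cong A R `` {z}"
    by (rule presented_carrierE)
  then have yz: "y @ z \<in> lists A" using y by simp
  show "X \<otimes>\<^bsub>presented_monoid A R\<^esub> Y \<otimes>\<^bsub>presented_monoid A R\<^esub> Z
      = X \<otimes>\<^bsub>presented_monoid A R\<^esub> (Y \<otimes>\<^bsub>presented_monoid A R\<^esub> Z)"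
    unfolding x y z presented_mult[OF x(1) y(1)] presented_mult[OF y(1) z(1)]
      presented_mult[OF xy z(1)] presented_mult[OF x(1) yz] by simp
next
  show "\<one>\<^bsub>presented_monoid A R\<^esub> \<in> carrier (presented_monoid A R)"
    by (simp add: presented_one presented_carrierI)
next
  fix X assume "X \<in> carrier (presented_monoid A R)"
  then obtain x where x: "x \<in> lists A" "X = word_cong A R `` {x}"
    by (rule presented_carrierE)
  show "\<one>\<^bsub>presented_monoid A R\<^esub> \<otimes>\<^bsub>presented_monoid A R\<^esub> X = X"
    "X \<otimes>\<^bsub>presented_monoid A R\<^esub> \<one>\<^bsub>presented_monoid A R\<^esub> = X"
    using x presented_mult[of "[]" A x R] presented_mult[of x A "[]" R]
    by (simp_all add: presented_one)
qed

lemma presented_is_group: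
  assumes inv: "\<And>a. a \<in> A \<Longrightarrow> \<exists>b \<in> A. ([b, a], []) \<in> word_cong A R"
  shows "group (presented_monoid A R)"
proof -
  have ex: "\<exists>y \<in> lists A. (y @ x, []) \<in> word_cong A R" if "x \<in> lists A" for x
    using that
  proof induction
    case Nil
    then show ?case by (auto intro: word_cong.refl)
  next
    case (Cons a x)
    then obtain y where y: "y \<in> lists A" "(y @ x, []) \<in> word_cong A R"
      by blast
    obtain b where b: "b \<in> A" "([b, a], []) \<in> word_cong A R"
      using inv[OF Cons.hyps(1)] by blast
    have "(y @ [b, a] @ x, y @ x) \<in> word_cong A R"
      using word_cong_context[OF b(2) y(1) Cons.hyps(2)] by simp
    then have "((y @ [b]) @ a # x, []) \<in> word_cong A R"
      using word_cong.trans[OF _ y(2)] by simp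
    moreover have "y @ [b] \<in> lists A" using y b by simp
    ultimately show ?case by blast
  qed
  interpret monoid "presented_monoid A R" by (rule presented_is_monoid)
  show ?thesis
  proof (rule group_l_invI)
    fix X assume "X \<in> carrier (presented_monoid A R)"
    then obtain x where x: "x \<in> lists A" "X = word_cong A R `` {x}"
      by (rule presented_carrierE)
    obtain y where y: "y \<in> lists A" "(y @ x, []) \<in> word_cong A R"
      using ex[OF x(1)] by blast
    show "\<exists>Y \<in> carrier (presented_monoid A R). Y \<otimes>\<^bsub>presented_monoid A R\<^esub> X
            = \<one>\<^bsub>presented_monoid A R\<^esub>"
    proof (rule bexI)
      show "(word_cong A R `` {y}) \<otimes>\<^bsub>presented_monoid A R\<^esub> X = \<one>\<^bsub>presented_monoid A R\<^esub>"
        unfolding x(2) presented_mult[OF y(1) x(1)] presented_one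
        by (rule equiv_class_eq[OF equiv_word_cong y(2)])
    qed (rule presented_carrierI[OF y(1)])
  qed
qed

lemma word_cong_free_group:
  assumes "s \<in> S"
  shows "([(s, b), (s, \<not> b)], []) \<in> word_cong (S \<times> UNIV) (free_group_rel S)"
  using assms by (intro word_cong_rel) (auto simp: free_group_rel_def)

lemma group_free_group: "group (free_group S)"
  unfolding free_group_def
proof (rule presented_is_group)
  fix a :: "'a \<times> bool" assume "a \<in> S \<times> UNIV"
  then obtain s b where a: "a = (s, b)" "s \<in> S" by auto
  then have "([(s, \<not> b), a], []) \<in> word_cong (S \<times> UNIV) (free_group_rel S)"
    using word_cong_free_group[of s S "\<not> b"] by simp
  moreover have "(s, \<not> b) \<in> S \<times> UNIV" using a by simp
  ultimately show "\<exists>b \<in> S \<times> UNIV. ([b, a], []) \<in> word_cong (S \<times> UNIV) (free_group_rel S)"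
    by blast
qed

lemma group_free_product:
  assumes "group G" "group H"
  shows "group (free_product G H)"
  unfolding free_product_def
proof (rule presented_is_group)
  interpret G: group G by fact
  interpret H: group H by fact
  let ?A = "carrier G <+> carrier H"
  let ?R = "free_product_rel G H"
  fix c assume "c \<in> ?A"
  then consider a where "a \<in> carrier G" "c = Inl a" | a where "a \<in> carrier H" "c = Inr a"
    by auto
  then show "\<exists>b \<in> ?A. ([b, c], []) \<in> word_cong ?A ?R"
  proof cases
    case 1
    let ?b = "inv\<^bsub>G\<^esub> a"
    have b: "?b \<otimes>\<^bsub>G\<^esub> a = \<one>\<^bsub>G\<^esub>" "?b \<in> carrier G" using 1 by simp_all
    then have "([Inl ?b, c], [Inl \<one>\<^bsub>G\<^esub>]) \<in> ?R"
      using 1 unfolding free_product_rel_def by force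
    then have "([Inl ?b, c], [Inl \<one>\<^bsub>G\<^esub>]) \<in> word_cong ?A ?R"
      using 1 b by (intro word_cong_rel) auto
    moreover have "([Inl \<one>\<^bsub>G\<^esub>], []) \<in> word_cong ?A ?R"
      by (rule word_cong_rel) (auto simp: free_product_rel_def)
    ultimately have "([Inl ?b, c], []) \<in> word_cong ?A ?R" by (rule word_cong.trans)
    then show ?thesis using b by (intro bexI[of _ "Inl ?b"]) auto
  next
    case 2
    let ?b = "inv\<^bsub>H\<^esub> a"
    have b: "?b \<otimes>\<^bsub>H\<^esub> a = \<one>\<^bsub>H\<^esub>" "?b \<in> carrier H" using 2 by simp_all
    then have "([Inr ?b, c], [Inr \<one>\<^bsub>H\<^esub>]) \<in> ?R"
      using 2 unfolding free_product_rel_def by force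
    then have "([Inr ?b, c], [Inr \<one>\<^bsub>H\<^esub>]) \<in> word_cong ?A ?R"
      using 2 b by (intro word_cong_rel) auto
    moreover have "([Inr \<one>\<^bsub>H\<^esub>], []) \<in> word_cong ?A ?R"
      by (rule word_cong_rel) (auto simp: free_product_rel_def)
    ultimately have "([Inr ?b, c], []) \<in> word_cong ?A ?R" by (rule word_cong.trans)
    then show ?thesis using b by (intro bexI[of _ "Inr ?b"]) auto
  qed
qed

lemma presented_universal:
  assumes H: "group H" and f: "f \<in> A \<rightarrow> carrier H"
    and R: "\<And>p q. (p, q) \<in> R \<Longrightarrow> p \<in> lists A \<Longrightarrow> q \<in> lists A \<Longrightarrow>
      foldr (\<lambda>a h. f a \<otimes>\<^bsub>H\<^esub> h) p \<one>\<^bsub>H\<^esub> = foldr (\<lambda>a h. f a \<otimes>\<^bsub>H\<^esub> h) q \<one>\<^bsub>H\<^esub>"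
    and P: "group (presented_monoid A R)"
  shows "\<exists>!\<phi>. \<phi> \<in> extensional (carrier (presented_monoid A R)) \<and>
    \<phi> \<in> hom (presented_monoid A R) H \<and> (\<forall>a \<in> A. \<phi> (word_cong A R `` {[a]}) = f a)"
proof -
  let ?P = "presented_monoid A R"
  let ?cl = "\<lambda>x. word_cong A R `` {x}"
  interpret H: group H by (rule H)
  define ev where "ev x = foldr (\<lambda>a h. f a \<otimes>\<^bsub>H\<^esub> h) x \<one>\<^bsub>H\<^esub>" for x
  have ev_closed: "ev x \<in> carrier H" if "x \<in> lists A" for x
    using that f by (induction) (auto simp: ev_def)
  have ev_append: "ev (x @ y) = ev x \<otimes>\<^bsub>H\<^esub> ev y" if "x \<in> lists A" "y \<in> lists A" for x y
    using that(1)
  proof induction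
    case Nil
    then show ?case using ev_closed[OF that(2)] by (simp add: ev_def)
  next
    case (Cons a x)
    then have "f a \<in> carrier H" using f by auto
    then show ?case
      using Cons ev_closed[of x] ev_closed[OF that(2)] H.m_assoc by (simp add: ev_def)
  qed
  have ev_cong: "ev x = ev y" if "(x, y) \<in> word_cong A R" for x y
    using that
  proof induction
    case (step p q x y)
    then have "ev p = ev q" using R by (simp add: ev_def)
    moreover have "p @ y \<in> lists A" "q @ y \<in> lists A" using step by simp_all
    ultimately show ?case using step ev_append by metis
  qed simp_all
  define \<phi> where "\<phi> = (\<lambda>X \<in> carrier ?P. ev (SOME x. x \<in> X))"
  have \<phi>: "\<phi> (?cl x) = ev x" if "x \<in> lists A" for x
  proof -
    have "(SOME y. y \<in> ?cl x) \<in> ?cl x"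
      by (rule someI[of _ x]) (simp add: word_cong.refl[OF that])
    then have "ev x = ev (SOME y. y \<in> ?cl x)" by (intro ev_cong) simp
    then show ?thesis by (simp only: \<phi>_def restrict_apply' presented_carrierI[OF that])
  qed
  have hom: "\<phi> \<in> hom ?P H"
  proof (rule homI)
    fix X assume "X \<in> carrier ?P"
    then obtain x where x: "x \<in> lists A" "X = ?cl x" by (rule presented_carrierE)
    then show "\<phi> X \<in> carrier H" using \<phi> ev_closed by simp
    fix Y assume "Y \<in> carrier ?P"
    then obtain y where y: "y \<in> lists A" "Y = ?cl y" by (rule presented_carrierE)
    have "x @ y \<in> lists A" using x y by simp
    then show "\<phi> (X \<otimes>\<^bsub>?P\<^esub> Y) = \<phi> X \<otimes>\<^bsub>H\<^esub> \<phi> Y"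
      unfolding x(2) y(2) presented_mult[OF x(1) y(1)] using x y \<phi> ev_append by simp
  qed
  have gen: "\<phi> (?cl [a]) = f a" if "a \<in> A" for a
    using \<phi>[of "[a]"] that funcset_mem[OF f that] by (simp add: ev_def)
  have uniq: "\<psi> = \<phi>" if \<psi>: "\<psi> \<in> extensional (carrier ?P)" "\<psi> \<in> hom ?P H"
    "\<forall>a \<in> A. \<psi> (?cl [a]) = f a" for \<psi>
  proof (rule extensionalityI[OF \<psi>(1)])
    show "\<phi> \<in> extensional (carrier ?P)" by (simp add: \<phi>_def)
    fix X assume "X \<in> carrier ?P"
    then obtain x where x: "x \<in> lists A" "X = ?cl x" by (rule presented_carrierE)
    have "\<psi> (?cl x) = ev x"
      using x(1)
    proof induction
      case Nil
      interpret group_hom ?P H \<psi> using P H \<psi>(2) by (simp add: group_hom_def group_hom_axioms_def)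
      show ?case using hom_one by (simp add: presented_one ev_def)
    next
      case (Cons a x)
      then have "[a] \<in> lists A" by simp
      then have "\<psi> (?cl (a # x)) = \<psi> (?cl [a]) \<otimes>\<^bsub>H\<^esub> \<psi> (?cl x)"
        using presented_mult[of "[a]" A x R] hom_mult[OF \<psi>(2)] Cons
        by (metis presented_carrierI append_Cons append_Nil)
      then show ?case using Cons \<psi>(3) by (simp add: ev_def)
    qed
    then show "\<psi> X = \<phi> X" using x \<phi> by simp
  qed
  show ?thesis
  proof (rule ex1I)
    show "\<phi> \<in> extensional (carrier ?P) \<and> \<phi> \<in> hom ?P H \<and> (\<forall>a \<in> A. \<phi> (?cl [a]) = f a)"
      using hom gen by (simp add: \<phi>_def)
  qed (use uniq in blast)
qed

definition free_gen :: "'s set \<Rightarrow> 's \<Rightarrow> ('s \<times> bool) list set" where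
  "free_gen S s = word_cong (S \<times> UNIV) (free_group_rel S) `` {[(s, True)]}"

lemma free_group_universal:
  assumes "group H" and f: "f \<in> S \<rightarrow> carrier H"
  shows "\<exists>!\<phi>. \<phi> \<in> extensional (carrier (free_group S)) \<and> \<phi> \<in> hom (free_group S) H \<and>
           (\<forall>s \<in> S. \<phi> (free_gen S s) = f s)"
proof -
  interpret H: group H by fact
  let ?A = "S \<times> (UNIV :: bool set)"
  let ?R = "free_group_rel S"
  let ?P = "presented_monoid ?A ?R"
  let ?cl = "\<lambda>x. word_cong ?A ?R `` {x}"
  let ?f = "\<lambda>(s, b). if b then f s else inv\<^bsub>H\<^esub> (f s)"
  have grp: "group ?P" using group_free_group[of S] by (simp add: free_group_def)
  interpret P: group ?P by (rule grp)
  have fs: "f s \<in> carrier H" if "s \<in> S" for s using that f by auto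
  have ex1: "\<exists>!\<phi>. \<phi> \<in> extensional (carrier ?P) \<and> \<phi> \<in> hom ?P H \<and> (\<forall>a \<in> ?A. \<phi> (?cl [a]) = ?f a)"
    by (rule presented_universal[OF \<open>group H\<close> _ _ grp]) (auto simp: fs free_group_rel_def)
  have "(\<forall>a \<in> ?A. \<phi> (?cl [a]) = ?f a) \<longleftrightarrow> (\<forall>s \<in> S. \<phi> (?cl [(s, True)]) = f s)"
    if \<phi>: "\<phi> \<in> hom ?P H" for \<phi>
  proof
    assume gen: "\<forall>s \<in> S. \<phi> (?cl [(s, True)]) = f s"
    interpret group_hom ?P H \<phi> using grp \<open>group H\<close> \<phi> by (simp add: group_hom_def group_hom_axioms_def)
    have "\<phi> (?cl [(s, False)]) = inv\<^bsub>H\<^esub> (f s)" if s: "s \<in> S" for s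
    proof -
      have l: "[(s, True)] \<in> lists ?A" "[(s, False)] \<in> lists ?A" using s by auto
      have "?cl [(s, False), (s, True)] = ?cl []"
        using equiv_class_eq[OF equiv_word_cong word_cong_free_group[OF s, of False]] by simp
      then have "?cl [(s, False)] \<otimes>\<^bsub>?P\<^esub> ?cl [(s, True)] = \<one>\<^bsub>?P\<^esub>"
        using presented_mult[OF l(2,1)] by (simp add: presented_one)
      then have "\<phi> (?cl [(s, False)]) \<otimes>\<^bsub>H\<^esub> f s = \<one>\<^bsub>H\<^esub>"
        using gen s hom_mult[OF presented_carrierI[OF l(2)] presented_carrierI[OF l(1)]] hom_one
        by simp
      then show ?thesis
        using H.inv_equality[OF _ fs[OF s]] hom_closed[OF presented_carrierI[OF l(2)]] by simp
    qed
    then show "\<forall>a \<in> ?A. \<phi> (?cl [a]) = ?f a" using gen by auto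
  qed auto
  then show ?thesis
    using ex1 unfolding free_group_def free_gen_def by (simp cong: conj_cong)
qed

definition free_incl :: "'a monoid \<Rightarrow> 'b monoid \<Rightarrow> 'a + 'b \<Rightarrow> ('a + 'b) list set" where
  "free_incl G H c = word_cong (carrier G <+> carrier H) (free_product_rel G H) `` {[c]}"

lemma free_product_universal:
  assumes "group G" "group H" "group K" and f: "f \<in> hom G K" and g: "g \<in> hom H K"
  shows "\<exists>!\<phi>. \<phi> \<in> extensional (carrier (free_product G H)) \<and> \<phi> \<in> hom (free_product G H) K \<and>
           (\<forall>a \<in> carrier G. \<phi> (free_incl G H (Inl a)) = f a) \<and>
           (\<forall>b \<in> carrier H. \<phi> (free_incl G H (Inr b)) = g b)"
proof -
  interpret f: group_hom G K f
    by (intro group_hom.intro group_hom_axioms.intro assms)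
  interpret g: group_hom H K g
    by (intro group_hom.intro group_hom_axioms.intro assms)
  let ?A = "carrier G <+> carrier H"
  let ?R = "free_product_rel G H"
  have grp: "group (presented_monoid ?A ?R)"
    using group_free_product[OF assms(1,2)] by (simp add: free_product_def)
  have "\<exists>!\<phi>. \<phi> \<in> extensional (carrier (presented_monoid ?A ?R)) \<and>
      \<phi> \<in> hom (presented_monoid ?A ?R) K \<and>
      (\<forall>c \<in> ?A. \<phi> (word_cong ?A ?R `` {[c]}) = case_sum f g c)"
  proof (rule presented_universal[OF \<open>group K\<close> _ _ grp])
    show "case_sum f g \<in> ?A \<rightarrow> carrier K" by auto
    fix p q
    assume "(p, q) \<in> ?R"
    then show "foldr (\<lambda>a h. case_sum f g a \<otimes>\<^bsub>K\<^esub> h) p \<one>\<^bsub>K\<^esub>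
        = foldr (\<lambda>a h. case_sum f g a \<otimes>\<^bsub>K\<^esub> h) q \<one>\<^bsub>K\<^esub>"
      by (auto simp: free_product_rel_def)
  qed
  moreover have "(\<forall>c \<in> ?A. P c) \<longleftrightarrow> (\<forall>a \<in> carrier G. P (Inl a)) \<and> (\<forall>b \<in> carrier H. P (Inr b))"
    for P by blast
  ultimately show ?thesis
    by (simp only: free_product_def free_incl_def sum.case)
qed

end

theory Submission
  imports Defs "HOL-Algebra.Generated_Groups" "HOL-Algebra.Weak_Morphisms"
begin

text \<open>
  A group is a groupoid with one object, so the cocycles on a category \<open>C\<close> are the same as the
  cocycles on its fundamental groupoid \<open>G\<close>, and the universal group of \<open>C\<close> serves \<open>G\<close> as well.
  If \<open>C\<close> is connected then \<open>G\<close> is transitive.  Choose a morphism \<open>\<tau> a\<close> from the base object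
  \<open>u\<close> (the image of \<open>w\<close>) to each object \<open>a\<close>.  Every morphism \<open>x\<close> from \<open>a\<close> to \<open>b\<close> is then
  \<open>\<tau> b \<cdot> g \<cdot> (\<tau> a)\<^sup>-\<^sup>1\<close> for a unique \<open>g\<close> in the isotropy group at \<open>u\<close>.  Hence a
  homomorphism \<open>\<beta>\<close> on the isotropy group and arbitrary group elements \<open>\<alpha> a\<close> define a cocycle
  \<open>x \<mapsto> \<alpha> b \<cdot> \<beta> g \<cdot> (\<alpha> a)\<^sup>-\<^sup>1\<close> (lemma \<open>cocycle_twisted\<close>).

  Apply this with values in the free product: \<open>\<beta>\<close> is the inclusion of the isotropy group, \<open>\<alpha> a\<close>
  is the free generator of \<open>a\<close> when \<open>a\<close> is not the image of \<open>v\<close>, and \<open>\<alpha>\<close> is trivial at the image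
  of \<open>v\<close>.  The cocycle induces a homomorphism \<open>\<Phi>\<close> from the universal group to the free
  product.  In the other direction, let \<open>\<rho>\<close> be the universal cocycle on \<open>G\<close>.  The
  generator of \<open>a\<close> goes to \<open>\<rho> (\<tau> a) \<cdot> \<rho> (\<tau> v)\<^sup>-\<^sup>1\<close> and \<open>g\<close> goes to
  \<open>\<rho> (\<tau> v) \<cdot> \<rho> g \<cdot> \<rho> (\<tau> v)\<^sup>-\<^sup>1\<close>, where \<open>\<tau> v\<close> is written for the path that
  ends at the image of \<open>v\<close>.  Conjugating by \<open>\<rho> (\<tau> v)\<close> is what allows \<open>v\<close> and \<open>w\<close> to
  differ.  The two maps are inverse to each other on generators (theorem
  \<open>universal_group_iso_free_product\<close>).

  Two supplements are needed.  First, the free generators are indexed by objects of \<open>C\<close>, whereas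
  \<open>\<alpha>\<close> is indexed by objects of \<open>G\<close>, so the bijection between the two sets of objects has to be
  extracted from the universal property.  It comes from two test groupoids: the pair groupoid on
  the objects of \<open>C\<close> separates objects, and the full subcategory of \<open>G\<close> on the image of \<open>C\<close>
  shows that there are no others.  Secondly, the universal properties speak about test objects on
  words over a sum of three types.  They extend to every test object that injects into those
  words, by transport of structure, and the free product does so because its elements are signed
  words in generators that are taken from the three types (lemma
  \<open>free_product_inj_on_universe\<close>).
\<close>

section \<open>Functors and cocycles\<close>

lemma is_functorD:
  assumes "is_functor C D F" "x \<in> mor C"
  shows "F x \<in> mor D" "rng D (F x) = F (rng C x)" "src D (F x) = F (src C x)"
  using assms unfolding is_functor_def by auto

lemma is_functor_comp_mor:
  assumes "is_functor C D F" "x \<in> mor C" "y \<in> mor C" "src C x = rng C y"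
  shows "F (comp C x y) = comp D (F x) (F y)"
  using assms unfolding is_functor_def by blast

lemma is_functor_obj:
  assumes "is_functor C D F" "s \<in> obj C"
  shows "F s \<in> obj D"
  using is_functorD[OF assms(1)] assms(2) unfolding obj_def by simp

lemma is_functor_homset:
  assumes "is_functor C D F" "x \<in> homset C s t"
  shows "F x \<in> homset D (F s) (F t)"
  using is_functorD[OF assms(1)] assms(2) unfolding homset_def by simp

lemma is_functor_compose:
  assumes F: "is_functor C D F" and F': "is_functor D E F'"
  shows "is_functor C E (\<lambda>x. F' (F x))"
  unfolding is_functor_def
proof (intro conjI ballI impI)
  fix x y assume xy: "x \<in> mor C" "y \<in> mor C" "src C x = rng C y"
  then have "src D (F x) = rng D (F y)" using is_functorD[OF F] by simp
  then show "F' (F (comp C x y)) = comp E (F' (F x)) (F' (F y))"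
    using xy is_functorD[OF F] is_functor_comp_mor[OF F] is_functor_comp_mor[OF F'] by simp
qed (use is_functorD[OF F] is_functorD[OF F'] in auto)

lemma is_functor_id:
  shows "is_functor C C (\<lambda>x. x)"
  unfolding is_functor_def by simp

text \<open>
  An identity morphism is idempotent, and the unit is the only idempotent of a group; this is
  why multiplicativity alone makes a map into a group a cocycle.
\<close>

lemma (in small_category) cocycleI:
  assumes H: "group H"
    and closed: "\<And>x. x \<in> mor C \<Longrightarrow> \<psi> x \<in> carrier H"
    and mult: "\<And>x y. x \<in> mor C \<Longrightarrow> y \<in> mor C \<Longrightarrow> src C x = rng C y
      \<Longrightarrow> \<psi> (comp C x y) = \<psi> x \<otimes>\<^bsub>H\<^esub> \<psi> y"
  shows "cocycle C H \<psi>"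
proof -
  interpret H: group H by (rule H)
  have "\<psi> s = \<one>\<^bsub>H\<^esub>" if "s \<in> obj C" for s
  proof -
    have s: "s \<in> mor C" "rng C s = s" "src C s = s" using that by (auto simp: obj_def)
    then have "\<psi> s \<otimes>\<^bsub>H\<^esub> \<psi> s = \<psi> s" using mult[of s s] rng_left_id[of s] by simp
    then show ?thesis using closed[OF s(1)] by simp
  qed
  then show ?thesis
    using closed mult rng_obj src_obj
    by (simp add: cocycle_def is_functor_def group_category_def)
qed

lemma cocycleD:
  assumes "cocycle C H \<psi>"
  shows "x \<in> mor C \<Longrightarrow> \<psi> x \<in> carrier H"
    and "x \<in> mor C \<Longrightarrow> y \<in> mor C \<Longrightarrow> src C x = rng C y
      \<Longrightarrow> \<psi> (comp C x y) = \<psi> x \<otimes>\<^bsub>H\<^esub> \<psi> y"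
    and "s \<in> obj C \<Longrightarrow> \<psi> s = \<one>\<^bsub>H\<^esub>"
  using assms by (auto simp: cocycle_def is_functor_def group_category_def obj_def)

lemma is_functor_group_category:
  assumes "group H" "group K" "h \<in> hom H K"
  shows "is_functor (group_category H) (group_category K) h"
  using group_hom.hom_one[of H K h] assms
  by (auto simp: is_functor_def group_category_def group_hom_def group_hom_axioms_def
      hom_mult hom_in_carrier)

lemma cocycle_hom:
  assumes "group H" "group K" "h \<in> hom H K" "cocycle C H \<psi>"
  shows "cocycle C K (\<lambda>x. h (\<psi> x))"
  using is_functor_compose[OF _ is_functor_group_category] assms by (auto simp: cocycle_def)

lemma cocycle_functor:
  assumes "is_functor C D F" "cocycle D H \<psi>"
  shows "cocycle C H (\<lambda>x. \<psi> (F x))"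
  using is_functor_compose assms unfolding cocycle_def by blast

lemma groupoid_group_category:
  assumes "group H"
  shows "groupoid (group_category H)"
proof -
  interpret H: group H by fact
  show ?thesis
    by unfold_locales
      (auto simp: group_category_def obj_def H.m_assoc intro!: bexI[of _ "inv\<^bsub>H\<^esub> _"])
qed


section \<open>Universal properties for test objects of any sufficiently small type\<close>

text \<open>
  Transport of structure along \<open>e\<close> turns \<open>H\<close> into a group on the type that the universal
  property quantifies over; the lift into the copy is then carried back.
\<close>

lemma universal_group_ex:
  fixes H :: "'k monoid" and e :: "'k \<Rightarrow> 'h"
  assumes U: "universal_group TYPE('h) C U j" and H: "group H"
    and e: "inj_on e (carrier H)" and \<psi>: "cocycle C H \<psi>"
  obtains h where "h \<in> hom U H" "\<And>x. x \<in> mor C \<Longrightarrow> h (j x) = \<psi> x"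
proof -
  let ?H = "image_group e H"
  let ?d = "inv_into (carrier H) e"
  have H': "group ?H" using group.inj_imp_image_group_is_group[OF H e] .
  have e_iso: "e \<in> iso H ?H" using inj_imp_image_group_iso[OF e] .
  then have d_hom: "?d \<in> hom ?H H" using group.iso_set_sym[OF H] by (auto simp: iso_def)
  have "cocycle C ?H (\<lambda>x. e (\<psi> x))"
    using e_iso by (intro cocycle_hom[OF H H' _ \<psi>]) (simp add: iso_def)
  then obtain h where h: "h \<in> hom U ?H" "\<forall>x \<in> mor C. e (\<psi> x) = h (j x)"
    using U H' unfolding universal_group_def by metis
  show thesis
  proof (rule that)
    show "?d \<circ> h \<in> hom U H" using hom_compose[OF h(1) d_hom] .
    fix x assume x: "x \<in> mor C"
    show "(?d \<circ> h) (j x) = \<psi> x"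
      using h(2)[rule_format, OF x, symmetric] cocycleD(1)[OF \<psi> x] e by simp
  qed
qed

lemma universal_group_eq:
  fixes H :: "'k monoid" and e :: "'k \<Rightarrow> 'h"
  assumes U: "universal_group TYPE('h) C U j" and H: "group H"
    and e: "inj_on e (carrier H)"
    and h: "h \<in> hom U H" "h' \<in> hom U H" and eq: "\<And>x. x \<in> mor C \<Longrightarrow> h (j x) = h' (j x)"
    and y: "y \<in> carrier U"
  shows "h y = h' y"
proof -
  let ?H = "image_group e H"
  have H': "group ?H" using group.inj_imp_image_group_is_group[OF H e] .
  have e_hom: "e \<in> hom H ?H" using inj_imp_image_group_iso[OF e] by (simp add: iso_def)
  have jU: "group U" "cocycle C U j" using U by (auto simp: universal_group_def)
  have he: "e \<circ> h \<in> hom U ?H" "e \<circ> h' \<in> hom U ?H" using hom_compose[OF _ e_hom] h by auto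
  have "cocycle C ?H (\<lambda>x. (e \<circ> h) (j x))"
    by (rule cocycle_hom[OF jU(1) H' he(1) jU(2)])
  let ?lift = "\<lambda>\<phi>. \<phi> \<in> extensional (carrier U) \<and> \<phi> \<in> hom U ?H \<and>
      (\<forall>x \<in> mor C. (e \<circ> h) (j x) = \<phi> (j x))"
  have restr: "restrict f (carrier U) \<in> hom U ?H" if "f \<in> hom U ?H" for f
    using that monoid.m_closed[OF group.is_monoid[OF jU(1)]] by (auto simp: hom_def)
  have "\<exists>!\<phi>. ?lift \<phi>"
    using U H' \<open>cocycle C ?H _\<close> unfolding universal_group_def by blast
  moreover have "?lift (restrict (e \<circ> h) (carrier U))" "?lift (restrict (e \<circ> h') (carrier U))"
    using restr[OF he(1)] restr[OF he(2)] cocycleD(1)[OF jU(2)] eq by simp_all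
  ultimately have "restrict (e \<circ> h) (carrier U) = restrict (e \<circ> h') (carrier U)"
    unfolding Ex1_def by blast
  then have "e (h y) = e (h' y)" using y by (auto dest: fun_cong[of _ _ y])
  then show ?thesis
    using inj_onD[OF e] hom_in_carrier[OF h(1) y] hom_in_carrier[OF h(2) y] by blast
qed

text \<open>
  Objects are morphisms here, so transporting the set of morphisms transports the whole category.
  This is the analogue for categories of \<^const>\<open>image_group\<close>.
\<close>

definition image_category :: "('k \<Rightarrow> 'h) \<Rightarrow> 'k category \<Rightarrow> 'h category" where
  "image_category e K =
     \<lparr>mor = e ` mor K,
      rng = (\<lambda>x. e (rng K (inv_into (mor K) e x))),
      src = (\<lambda>x. e (src K (inv_into (mor K) e x))),
      comp = (\<lambda>x y. e (comp K (inv_into (mor K) e x) (inv_into (mor K) e y)))\<rparr>"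

lemma is_functor_image_category:
  assumes "small_category K" "inj_on e (mor K)"
  shows "is_functor K (image_category e K) e"
  using assms by (auto simp: is_functor_def image_category_def)

lemma is_functor_inv_image_category:
  assumes K: "small_category K" and e: "inj_on e (mor K)"
  shows "is_functor (image_category e K) K (inv_into (mor K) e)"
proof -
  interpret small_category K by (rule K)
  have "s \<in> mor K" if "s \<in> obj K" for s using that by (simp add: obj_def)
  then have "rng K x \<in> mor K" "src K x \<in> mor K" if "x \<in> mor K" for x
    using rng_obj src_obj that by auto
  moreover have "src K x = rng K y"
    if "e (src K x) = e (rng K y)" "x \<in> mor K" "y \<in> mor K" for x y
    using inj_onD[OF e that(1)] calculation that by blast
  ultimately show ?thesis
    using e comp_mor by (auto simp: is_functor_def image_category_def)
qed

lemma groupoid_image_category: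
  assumes K: "groupoid K" and e: "inj_on e (mor K)"
  shows "groupoid (image_category e K)"
proof -
  interpret groupoid K by (rule K)
  have ids: "rng K x \<in> mor K" "src K x \<in> mor K" if "x \<in> mor K" for x
    using rng_obj[OF that] src_obj[OF that] by (auto simp: obj_def)
  have ids2: "rng K (rng K x) = rng K x" "src K (rng K x) = rng K x"
     "rng K (src K x) = src K x" "src K (src K x) = src K x" if "x \<in> mor K" for x
    using rng_obj[OF that] src_obj[OF that] by (auto simp: obj_def)
  have match: "e (src K x) = e (rng K y) \<longleftrightarrow> src K x = rng K y"
    if "x \<in> mor K" "y \<in> mor K" for x y
    using inj_on_eq_iff[OF e] ids that by blast
  have sel [simp]: "mor (image_category e K) = e ` mor K"
    "x \<in> mor K \<Longrightarrow> rng (image_category e K) (e x) = e (rng K x)"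
    "x \<in> mor K \<Longrightarrow> src (image_category e K) (e x) = e (src K x)"
    "x \<in> mor K \<Longrightarrow> y \<in> mor K \<Longrightarrow> comp (image_category e K) (e x) (e y) = e (comp K x y)" for x y
    using e by (simp_all add: image_category_def)
  have objI: "e s \<in> obj (image_category e K)" if "s \<in> obj K" for s
    using that by (auto simp: obj_def)
  show ?thesis
  proof unfold_locales
    fix x assume "x \<in> mor (image_category e K)"
    then obtain a where a: "a \<in> mor K" "x = e a" by auto
    obtain b where b: "b \<in> mor K" "src K b = rng K a" "rng K b = src K a"
      "comp K a b = rng K a" "comp K b a = src K a"
      using invertible[OF a(1)] by blast
    show "\<exists>y \<in> mor (image_category e K). src (image_category e K) y = rng (image_category e K) x \<and>
       rng (image_category e K) y = src (image_category e K) x \<and>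
       comp (image_category e K) x y = rng (image_category e K) x \<and>
       comp (image_category e K) y x = src (image_category e K) x"
      using a b by (intro bexI[of _ "e b"]) auto
  qed (auto simp: ids ids2 match comp_mor rng_comp src_comp rng_left_id src_right_id comp_assoc
      intro!: objI rng_obj src_obj)
qed

lemma fundamental_groupoid_ex:
  fixes K :: "'k category" and e :: "'k \<Rightarrow> 'h"
  assumes G: "fundamental_groupoid TYPE('h) C G i" and K: "groupoid K"
    and e: "inj_on e (mor K)" and F: "is_functor C K F"
  obtains F' where "is_functor G K F'" "\<And>x. x \<in> mor C \<Longrightarrow> F' (i x) = F x"
proof -
  let ?K = "image_category e K"
  let ?d = "inv_into (mor K) e"
  have Kc: "small_category K" using K by (rule groupoid.axioms)
  have "is_functor C ?K (\<lambda>x. e (F x))"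
    by (rule is_functor_compose[OF F is_functor_image_category[OF Kc e]])
  then obtain F' where F': "is_functor G ?K F'" "\<forall>x \<in> mor C. e (F x) = F' (i x)"
    using G groupoid_image_category[OF K e] unfolding fundamental_groupoid_def by metis
  show thesis
  proof (rule that)
    show "is_functor G K (\<lambda>x. ?d (F' x))"
      by (rule is_functor_compose[OF F'(1) is_functor_inv_image_category[OF Kc e]])
    fix x assume x: "x \<in> mor C"
    show "?d (F' (i x)) = F x"
      using F'(2)[rule_format, OF x, symmetric] is_functorD(1)[OF F x] e by simp
  qed
qed

lemma fundamental_groupoid_eq:
  fixes K :: "'k category" and e :: "'k \<Rightarrow> 'h"
  assumes G: "fundamental_groupoid TYPE('h) C G i" and K: "groupoid K"
    and e: "inj_on e (mor K)"
    and F: "is_functor G K F" "is_functor G K F'"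
    and eq: "\<And>x. x \<in> mor C \<Longrightarrow> F (i x) = F' (i x)"
    and y: "y \<in> mor G"
  shows "F y = F' y"
proof -
  let ?K = "image_category e K"
  have Kc: "small_category K" using K by (rule groupoid.axioms)
  have iG: "groupoid G" "is_functor C G i" using G by (auto simp: fundamental_groupoid_def)
  interpret G: groupoid G by (rule iG)
  have eF: "is_functor G ?K (\<lambda>x. e (F x))" "is_functor G ?K (\<lambda>x. e (F' x))"
    using is_functor_compose[OF _ is_functor_image_category[OF Kc e]] F by auto
  have "is_functor C ?K (\<lambda>x. e (F (i x)))"
    by (rule is_functor_compose[OF iG(2) eF(1)])
  let ?lift = "\<lambda>\<phi>. \<phi> \<in> extensional (mor G) \<and> is_functor G ?K \<phi> \<and>
      (\<forall>x \<in> mor C. e (F (i x)) = \<phi> (i x))"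
  have restr: "is_functor G ?K (restrict f (mor G))" if "is_functor G ?K f" for f
    using that G.comp_mor G.rng_obj G.src_obj by (simp add: is_functor_def obj_def)
  have "\<exists>!\<phi>. ?lift \<phi>"
    using G groupoid_image_category[OF K e] \<open>is_functor C ?K _\<close>
    unfolding fundamental_groupoid_def by blast
  moreover have "?lift (restrict (\<lambda>x. e (F x)) (mor G))" "?lift (restrict (\<lambda>x. e (F' x)) (mor G))"
    using restr[OF eF(1)] restr[OF eF(2)] is_functorD(1)[OF iG(2)] eq by simp_all
  ultimately have "restrict (\<lambda>x. e (F x)) (mor G) = restrict (\<lambda>x. e (F' x)) (mor G)"
    unfolding Ex1_def by blast
  then have "e (F y) = e (F' y)" using y by (auto dest: fun_cong[of _ _ y])
  then show ?thesis
    using inj_onD[OF e] is_functorD(1)[OF F(1) y] is_functorD(1)[OF F(2) y] by blast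
qed


section \<open>Words in generators\<close>

text \<open>
  Signs of letters are recorded by two distinct letters in a second half of the word, so that
  signed words fit into the type of unsigned ones.
\<close>

lemma inj_signed_words:
  fixes a b :: 'x
  assumes "a \<noteq> b"
  shows "inj (\<lambda>xs. map fst xs @ map (\<lambda>x. if snd x then a else b) xs)"
proof (rule injI)
  fix xs ys :: "('x \<times> bool) list"
  assume eq: "map fst xs @ map (\<lambda>x. if snd x then a else b) xs
      = map fst ys @ map (\<lambda>x. if snd x then a else b) ys"
  have "length xs + length xs = length ys + length ys"
    using arg_cong[OF eq, of length] by (simp only: length_append length_map)
  then have "length xs = length ys" by simp
  with eq have fst: "map fst xs = map fst ys"
    and "map (\<lambda>x. if snd x then a else b) xs = map (\<lambda>x. if snd x then a else b) ys"
    by simp_all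
  then have "map snd xs = map snd ys"
    using assms by (auto simp: list_eq_iff_nth_eq split: if_splits)
  then show "xs = ys" using fst by (metis zip_map_fst_snd)
qed

lemma (in group) generate_range_word:
  assumes \<gamma>: "\<And>a. \<gamma> a \<in> carrier G" and "x \<in> generate G (range \<gamma>)"
  shows "\<exists>ws. x = foldr (\<lambda>(a, b) h. (if b then \<gamma> a else inv \<gamma> a) \<otimes> h) ws \<one>"
proof -
  define ev where "ev ws = foldr (\<lambda>(a, b) h. (if b then \<gamma> a else inv \<gamma> a) \<otimes> h) ws \<one>" for ws
  have ev_closed: "ev ws \<in> carrier G" for ws
    by (induction ws) (auto simp: ev_def \<gamma>)
  have ev_append: "ev (vs @ ws) = ev vs \<otimes> ev ws" for vs ws
  proof (induction vs)
    case (Cons a vs)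
    then show ?case using ev_closed[of vs] ev_closed[of ws] \<gamma> m_assoc
      by (cases a) (auto simp: ev_def)
  qed (use ev_closed[of ws] in \<open>simp add: ev_def\<close>)
  have "\<exists>ws. x = ev ws"
    using assms(2)
  proof induction
    case one
    show ?case by (rule exI[of _ "[]"]) (simp add: ev_def)
  next
    case (incl h)
    then obtain a where "h = \<gamma> a" by blast
    then show ?case by (intro exI[of _ "[(a, True)]"]) (simp add: ev_def \<gamma>)
  next
    case (inv h)
    then obtain a where "h = \<gamma> a" by blast
    then show ?case by (intro exI[of _ "[(a, False)]"]) (simp add: ev_def \<gamma>)
  next
    case (eng h1 h2)
    then show ?case using ev_append by metis
  qed
  then show ?thesis by (simp add: ev_def)
qed

text \<open>
  Signed words in the generators cover the group, so choosing a word for each element is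
  injective; the two distinct elements \<open>p\<close> and \<open>q\<close> are the letters that encode the signs.
\<close>

lemma (in group) generated_inj_on_words:
  fixes \<gamma> :: "'x \<Rightarrow> 'a" and p q :: 'x
  assumes \<gamma>: "\<And>a. \<gamma> a \<in> carrier G" and gen: "carrier G \<subseteq> generate G (range \<gamma>)"
    and "p \<noteq> q"
  obtains e :: "'a \<Rightarrow> 'x list" where "inj_on e (carrier G)"
proof -
  define ev where "ev ws = foldr (\<lambda>(a, b) h. (if b then \<gamma> a else inv \<gamma> a) \<otimes> h) ws \<one>" for ws
  have "carrier G \<subseteq> range ev"
    using generate_range_word[of \<gamma>, OF \<gamma>] gen unfolding ev_def by blast
  then have "inj_on (inv_into UNIV ev) (carrier G)"
    by (rule inj_on_inv_into)
  moreover have "inj_on (\<lambda>xs. map fst xs @ map (\<lambda>x. if snd x then p else q) xs)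
      (inv_into UNIV ev ` carrier G)"
    using inj_signed_words[OF \<open>p \<noteq> q\<close>] by (rule inj_on_subset) simp
  ultimately show thesis using that comp_inj_on by blast
qed

lemma hom_eq_on_generate:
  assumes "group_hom G H f" "group_hom G H g" and X: "X \<subseteq> carrier G"
    and eq: "\<And>x. x \<in> X \<Longrightarrow> f x = g x" and "y \<in> generate G X"
  shows "f y = g y"
proof -
  interpret f: group_hom G H f by fact
  interpret g: group_hom G H g by fact
  show ?thesis
    using \<open>y \<in> generate G X\<close>
  proof induction
    case (inv h)
    then show ?case using X eq f.hom_inv g.hom_inv by (metis subsetD)
  next
    case (eng h1 h2)
    then show ?case using f.G.generate_in_carrier[OF X] by simp
  qed (simp_all add: eq)
qed

lemma presented_generated:
  "carrier (presented_monoid A R)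
     \<subseteq> generate (presented_monoid A R) ((\<lambda>a. word_cong A R `` {[a]}) ` A)"
proof
  fix X assume "X \<in> carrier (presented_monoid A R)"
  then obtain x where x: "x \<in> lists A" "X = word_cong A R `` {x}" by (rule presented_carrierE)
  show "X \<in> generate (presented_monoid A R) ((\<lambda>a. word_cong A R `` {[a]}) ` A)"
    unfolding x(2) using x(1)
  proof induction
    case Nil
    show ?case using generate.one by (metis presented_one)
  next
    case (Cons a x)
    then have "word_cong A R `` {a # x}
        = word_cong A R `` {[a]} \<otimes>\<^bsub>presented_monoid A R\<^esub> word_cong A R `` {x}"
      using presented_mult[of "[a]" A x R] by simp
    moreover have "word_cong A R `` {[a]}
        \<in> generate (presented_monoid A R) ((\<lambda>a. word_cong A R `` {[a]}) ` A)"
      using Cons.hyps by (intro generate.incl imageI)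
    ultimately show ?case using Cons.IH generate.eng by metis
  qed
qed

lemma presented_rel:
  assumes "(p, q) \<in> R" "p \<in> lists A" "q \<in> lists A"
  shows "word_cong A R `` {p} = word_cong A R `` {q}"
  using equiv_class_eq[OF equiv_word_cong word_cong_rel[OF assms]] .

lemma (in group) generate_mono_closed:
  assumes "X \<subseteq> generate G Y" "Y \<subseteq> carrier G"
  shows "generate G X \<subseteq> generate G Y"
  using generate_subgroup_incl[OF assms(1) generate_is_subgroup[OF assms(2)]] .

lemma free_gen_closed: "s \<in> S \<Longrightarrow> free_gen S s \<in> carrier (free_group S)"
  unfolding free_gen_def free_group_def by (rule presented_carrierI) simp

text \<open>
  The presentation generates the group by its letters, half of which are the inverses of free
  generators.
\<close>

lemma free_group_generated:
  "carrier (free_group S) \<subseteq> generate (free_group S) (free_gen S ` S)"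
proof -
  let ?F = "free_group S"
  let ?cl = "\<lambda>x. word_cong (S \<times> UNIV) (free_group_rel S) `` {x}"
  interpret F: group ?F by (rule group_free_group)
  have "?cl [(s, b)] \<in> generate ?F (free_gen S ` S)" if s: "s \<in> S" for s b
  proof (cases b)
    case True
    then show ?thesis using s generate.incl[OF imageI[OF s, of "free_gen S"]] by (simp add: free_gen_def)
  next
    case False
    have l: "[(s, True)] \<in> lists (S \<times> UNIV)" "[(s, False)] \<in> lists (S \<times> UNIV)" using s by auto
    have "?cl [(s, False), (s, True)] = ?cl []"
      by (rule presented_rel) (use s in \<open>auto simp: free_group_rel_def\<close>)
    then have "?cl [(s, False)] \<otimes>\<^bsub>?F\<^esub> free_gen S s = \<one>\<^bsub>?F\<^esub>"
      using presented_mult[OF l(2,1)] by (simp add: presented_one free_group_def free_gen_def)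
    moreover have "?cl [(s, False)] \<in> carrier ?F"
      unfolding free_group_def by (rule presented_carrierI[OF l(2)])
    ultimately have "inv\<^bsub>?F\<^esub> (free_gen S s) = ?cl [(s, False)]"
      using F.inv_equality free_gen_closed[OF s] by blast
    then show ?thesis using False generate.inv[of "free_gen S s" "free_gen S ` S" ?F] s by simp
  qed
  then have "generate ?F ((\<lambda>a. ?cl [a]) ` (S \<times> UNIV)) \<subseteq> generate ?F (free_gen S ` S)"
    by (intro F.generate_mono_closed) (auto simp: free_gen_closed)
  then show ?thesis using presented_generated unfolding free_group_def by blast
qed

lemma free_incl_closed:
  "c \<in> Sum_Type.Plus (carrier G) (carrier H)
     \<Longrightarrow> free_incl G H c \<in> carrier (free_product G H)"
  unfolding free_incl_def free_product_def by (rule presented_carrierI) simp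

lemma free_incl_mult:
  assumes "c \<in> Sum_Type.Plus (carrier G) (carrier H)" "d \<in> Sum_Type.Plus (carrier G) (carrier H)"
    and "e \<in> Sum_Type.Plus (carrier G) (carrier H)"
    and "([c, d], [e]) \<in> free_product_rel G H"
  shows "free_incl G H e = free_incl G H c \<otimes>\<^bsub>free_product G H\<^esub> free_incl G H d"
  using presented_mult[of "[c]" "Sum_Type.Plus (carrier G) (carrier H)" "[d]" "free_product_rel G H"]
    presented_rel[OF assms(4), of "Sum_Type.Plus (carrier G) (carrier H)"] assms(1-3)
  by (simp add: free_incl_def free_product_def)

lemma free_incl_Inl_hom:
  assumes "group G"
  shows "(\<lambda>a. free_incl G H (Inl a)) \<in> hom G (free_product G H)"
proof -
  interpret G: group G by fact
  show ?thesis
  proof (rule homI)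
    fix a b assume "a \<in> carrier G" "b \<in> carrier G"
    then show "free_incl G H (Inl (a \<otimes>\<^bsub>G\<^esub> b))
        = free_incl G H (Inl a) \<otimes>\<^bsub>free_product G H\<^esub> free_incl G H (Inl b)"
      by (intro free_incl_mult) (auto simp: free_product_rel_def)
  qed (simp add: free_incl_closed InlI)
qed

lemma free_incl_Inr_hom:
  assumes "group H"
  shows "(\<lambda>b. free_incl G H (Inr b)) \<in> hom H (free_product G H)"
proof -
  interpret H: group H by fact
  show ?thesis
  proof (rule homI)
    fix a b assume "a \<in> carrier H" "b \<in> carrier H"
    then show "free_incl G H (Inr (a \<otimes>\<^bsub>H\<^esub> b))
        = free_incl G H (Inr a) \<otimes>\<^bsub>free_product G H\<^esub> free_incl G H (Inr b)"
      by (intro free_incl_mult) (auto simp: free_product_rel_def)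
  qed (simp add: free_incl_closed InrI)
qed

lemma free_product_generated:
  assumes "group G" "group H" and X: "X \<subseteq> carrier G" "carrier G \<subseteq> generate G X"
  shows "carrier (free_product G H) \<subseteq> generate (free_product G H)
    ((\<lambda>a. free_incl G H (Inl a)) ` X \<union> (\<lambda>b. free_incl G H (Inr b)) ` carrier H)"
    (is "_ \<subseteq> generate ?P ?Y")
proof -
  let ?l = "\<lambda>a. free_incl G H (Inl a)"
  interpret P: group ?P by (rule group_free_product[OF assms(1,2)])
  interpret l: group_hom G ?P ?l
    using free_incl_Inl_hom[OF assms(1)] assms(1) P.group_axioms
    by (simp add: group_hom_def group_hom_axioms_def)
  have Y: "?Y \<subseteq> carrier ?P" using X(1) by (auto intro!: free_incl_closed)
  have "?l ` carrier G \<subseteq> generate ?P (?l ` X)"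
    using l.generate_img[OF X(1)] X(2) by auto
  also have "\<dots> \<subseteq> generate ?P ?Y" by (rule P.mono_generate) simp
  finally have "free_incl G H ` (Sum_Type.Plus (carrier G) (carrier H)) \<subseteq> generate ?P ?Y"
    by (auto intro: generate.incl)
  then have "generate ?P (free_incl G H ` (Sum_Type.Plus (carrier G) (carrier H))) \<subseteq> generate ?P ?Y"
    using Y by (rule P.generate_mono_closed)
  then show ?thesis
    using presented_generated[of "Sum_Type.Plus (carrier G) (carrier H)" "free_product_rel G H"]
    unfolding free_product_def free_incl_def by blast
qed


section \<open>Cocycles on a transitive groupoid\<close>

context groupoid
begin

definition inv_mor :: "'a \<Rightarrow> 'a" where
  "inv_mor x = (SOME y. y \<in> mor C \<and> src C y = rng C x \<and> rng C y = src C x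
      \<and> comp C x y = rng C x \<and> comp C y x = src C x)"

lemma inv_mor:
  assumes "x \<in> mor C"
  shows "inv_mor x \<in> mor C" "src C (inv_mor x) = rng C x" "rng C (inv_mor x) = src C x"
    "comp C x (inv_mor x) = rng C x" "comp C (inv_mor x) x = src C x"
proof -
  have "\<exists>y. y \<in> mor C \<and> src C y = rng C x \<and> rng C y = src C x
      \<and> comp C x y = rng C x \<and> comp C y x = src C x"
    using invertible[OF assms] by blast
  from someI_ex[OF this, folded inv_mor_def]
  show "inv_mor x \<in> mor C" "src C (inv_mor x) = rng C x" "rng C (inv_mor x) = src C x"
    "comp C x (inv_mor x) = rng C x" "comp C (inv_mor x) x = src C x" by blast+
qed

lemma comp_inv_mor_cancel:
  assumes "x \<in> mor C" "y \<in> mor C"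
  shows "rng C x = rng C y \<Longrightarrow> comp C x (comp C (inv_mor x) y) = y"
    and "src C x = rng C y \<Longrightarrow> comp C (inv_mor x) (comp C x y) = y"
  using assms inv_mor[OF assms(1)] rng_left_id comp_assoc[symmetric] by simp_all

lemma group_isotropy_group:
  assumes "s \<in> obj C"
  shows "group (isotropy_group C s)"
proof (rule groupI)
  have s: "s \<in> mor C" "rng C s = s" "src C s = s" using assms by (auto simp: obj_def)
  then show "\<one>\<^bsub>isotropy_group C s\<^esub> \<in> carrier (isotropy_group C s)"
    by (simp add: isotropy_group_def homset_def)
  fix x assume "x \<in> carrier (isotropy_group C s)"
  then have x: "x \<in> mor C" "rng C x = s" "src C x = s"
    by (auto simp: isotropy_group_def homset_def)
  then show "\<one>\<^bsub>isotropy_group C s\<^esub> \<otimes>\<^bsub>isotropy_group C s\<^esub> x = x"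
    using rng_left_id[of x] by (simp add: isotropy_group_def)
  show "\<exists>y \<in> carrier (isotropy_group C s). y \<otimes>\<^bsub>isotropy_group C s\<^esub> x = \<one>\<^bsub>isotropy_group C s\<^esub>"
    using inv_mor[OF x(1)] x
    by (intro bexI[of _ "inv_mor x"]) (auto simp: isotropy_group_def homset_def)
qed (auto simp: isotropy_group_def homset_def comp_mor rng_comp src_comp comp_assoc)

lemma cocycle_inv_mor:
  assumes "group H" "cocycle C H \<psi>" "x \<in> mor C"
  shows "\<psi> (inv_mor x) = inv\<^bsub>H\<^esub> (\<psi> x)"
proof -
  interpret H: group H by fact
  have "\<psi> (inv_mor x) \<otimes>\<^bsub>H\<^esub> \<psi> x = \<psi> (src C x)"
    using cocycleD(2)[OF assms(2) inv_mor(1)[OF assms(3)] assms(3)] inv_mor(2,5)[OF assms(3)]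
    by simp
  then show ?thesis
    using H.inv_equality cocycleD(1)[OF assms(2)] cocycleD(3)[OF assms(2)] inv_mor(1) src_obj assms(3)
    by metis
qed

end

lemma (in group) inv_cancel_left:
  assumes "x \<in> carrier G" "y \<in> carrier G"
  shows "inv x \<otimes> (x \<otimes> y) = y" "x \<otimes> (inv x \<otimes> y) = y"
  using assms by (simp_all add: m_assoc[symmetric])

text \<open>
  The chosen morphisms \<open>\<tau> a\<close> from \<open>u\<close> to the objects \<open>a\<close> make the groupoid transitive.  The
  loop \<open>\<tau> u\<close> at the base is arbitrary, so it appears as a correction in the calculations.
\<close>

locale based_groupoid = groupoid G for G :: "'g category" +
  fixes u :: 'g and \<tau> :: "'g \<Rightarrow> 'g"
  assumes base_obj: "u \<in> obj G"
    and path: "a \<in> obj G \<Longrightarrow> \<tau> a \<in> homset G a u"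
begin

definition to_base :: "'g \<Rightarrow> 'g" where
  "to_base x = comp G (inv_mor (\<tau> (rng G x))) (comp G x (\<tau> (src G x)))"

lemma path_mor:
  assumes "a \<in> obj G"
  shows "\<tau> a \<in> mor G" "rng G (\<tau> a) = a" "src G (\<tau> a) = u"
  using path[OF assms] by (auto simp: homset_def)

lemma path_base: "\<tau> u \<in> carrier (isotropy_group G u)"
  using path[OF base_obj] by (simp add: isotropy_group_def)

lemma to_base_closed: "x \<in> mor G \<Longrightarrow> to_base x \<in> carrier (isotropy_group G u)"
  using path_mor rng_obj src_obj inv_mor comp_mor rng_comp src_comp
  by (simp add: to_base_def isotropy_group_def homset_def)

text \<open>
  Retracting all morphisms to loops at the base along \<open>\<tau>\<close> is a cocycle into the isotropy group,
  because the path to the middle object cancels.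
\<close>

lemma to_base_comp:
  assumes "x \<in> mor G" "y \<in> mor G" "src G x = rng G y"
  shows "to_base (comp G x y) = to_base x \<otimes>\<^bsub>isotropy_group G u\<^esub> to_base y"
  using assms path_mor rng_obj src_obj inv_mor comp_mor rng_comp src_comp
  by (simp add: to_base_def isotropy_group_def comp_assoc comp_inv_mor_cancel)

lemma to_base_path: "a \<in> obj G \<Longrightarrow> to_base (\<tau> a) = \<tau> u"
  using path_mor base_obj comp_inv_mor_cancel(2)[of "\<tau> a" "\<tau> u"] by (simp add: to_base_def)

lemma to_base_isotropy:
  assumes "x \<in> carrier (isotropy_group G u)"
  shows "\<tau> u \<otimes>\<^bsub>isotropy_group G u\<^esub> to_base x = x \<otimes>\<^bsub>isotropy_group G u\<^esub> \<tau> u"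
  using assms path_mor[OF base_obj] comp_mor rng_comp
  by (simp add: to_base_def isotropy_group_def homset_def comp_inv_mor_cancel)

lemma cocycle_to_base:
  assumes "group H" "cocycle G H \<psi>" "x \<in> mor G"
  shows "\<psi> (to_base x) = inv\<^bsub>H\<^esub> (\<psi> (\<tau> (rng G x))) \<otimes>\<^bsub>H\<^esub> (\<psi> x \<otimes>\<^bsub>H\<^esub> \<psi> (\<tau> (src G x)))"
  using assms path_mor rng_obj src_obj inv_mor comp_mor rng_comp cocycleD(2)[OF assms(2)]
    cocycle_inv_mor[OF assms(1,2)]
  by (simp add: to_base_def)

text \<open>
  A cocycle can be twisted by arbitrary group elements at the objects: the one at the middle
  object cancels.  The free factor of the universal group records this freedom.
\<close>

lemma cocycle_twisted:
  assumes H: "group H" and \<alpha>: "\<And>a. a \<in> obj G \<Longrightarrow> \<alpha> a \<in> carrier H"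
    and \<beta>: "\<beta> \<in> hom (isotropy_group G u) H"
  shows "cocycle G H
    (\<lambda>x. \<alpha> (rng G x) \<otimes>\<^bsub>H\<^esub> (\<beta> (to_base x) \<otimes>\<^bsub>H\<^esub> inv\<^bsub>H\<^esub> (\<alpha> (src G x))))"
proof -
  interpret H: group H by (rule H)
  have \<beta>_closed: "\<beta> (to_base x) \<in> carrier H" if "x \<in> mor G" for x
    using hom_in_carrier[OF \<beta> to_base_closed[OF that]] .
  show ?thesis
  proof (rule cocycleI[OF H])
    fix x y assume xy: "x \<in> mor G" "y \<in> mor G" "src G x = rng G y"
    then have "\<beta> (to_base (comp G x y)) = \<beta> (to_base x) \<otimes>\<^bsub>H\<^esub> \<beta> (to_base y)"
      using to_base_comp hom_mult[OF \<beta>] to_base_closed by simp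
    then show "\<alpha> (rng G (comp G x y)) \<otimes>\<^bsub>H\<^esub> (\<beta> (to_base (comp G x y))
          \<otimes>\<^bsub>H\<^esub> inv\<^bsub>H\<^esub> (\<alpha> (src G (comp G x y))))
        = \<alpha> (rng G x) \<otimes>\<^bsub>H\<^esub> (\<beta> (to_base x) \<otimes>\<^bsub>H\<^esub> inv\<^bsub>H\<^esub> (\<alpha> (src G x)))
          \<otimes>\<^bsub>H\<^esub> (\<alpha> (rng G y) \<otimes>\<^bsub>H\<^esub> (\<beta> (to_base y) \<otimes>\<^bsub>H\<^esub> inv\<^bsub>H\<^esub> (\<alpha> (src G y))))"
      using xy \<alpha> \<beta>_closed rng_obj src_obj rng_comp src_comp
      by (simp add: H.m_assoc H.inv_cancel_left)
  qed (use \<alpha> \<beta>_closed rng_obj src_obj in simp)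
qed

text \<open>
  The two hypotheses \<open>factor\<close> and \<open>endo\<close> are the instances of the universal property of
  \<open>(U, \<rho>)\<close> that the proof uses: existence for test cocycles into the free product, and
  uniqueness for endomorphisms of \<open>U\<close>.  They stand for the full property because a hypothesis
  cannot range over test groups of all types.  The bijection \<open>b\<close> names the objects other than \<open>v\<close> by free generators.
\<close>

theorem universal_group_iso_free_product:
  fixes U :: "'u monoid" and S :: "'s set" and b :: "'g \<Rightarrow> 's"
  defines "P \<equiv> free_product (free_group S) (isotropy_group G u)"
  assumes v: "v \<in> obj G" and b: "bij_betw b (obj G - {v}) S"
    and U: "group U" and \<rho>: "cocycle G U \<rho>"
    and factor: "\<And>\<chi>. cocycle G P \<chi> \<Longrightarrow> \<exists>\<Phi> \<in> hom U P. \<forall>x \<in> mor G. \<Phi> (\<rho> x) = \<chi> x"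
    and endo: "\<And>h y. \<lbrakk>h \<in> hom U U; \<And>x. x \<in> mor G \<Longrightarrow> h (\<rho> x) = \<rho> x; y \<in> carrier U\<rbrakk>
      \<Longrightarrow> h y = y"
  shows "U \<cong> P"
proof -
  let ?F = "free_group S" and ?I = "isotropy_group G u"
  let ?f = "\<lambda>s. free_incl ?F ?I (Inl (free_gen S s))" and ?\<beta> = "\<lambda>g. free_incl ?F ?I (Inr g)"
  have F: "group ?F" by (rule group_free_group)
  have I: "group ?I" by (rule group_isotropy_group[OF base_obj])
  have P: "group P" unfolding P_def by (rule group_free_product[OF F I])
  interpret U: group U by (rule U)
  interpret P: group P by (rule P)
  have \<beta>: "?\<beta> \<in> hom ?I P" unfolding P_def by (rule free_incl_Inr_hom[OF I])
  have f_closed: "?f s \<in> carrier P" if "s \<in> S" for s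
    unfolding P_def using that by (intro free_incl_closed InlI free_gen_closed)
  define \<alpha> where "\<alpha> a = (if a = v then \<one>\<^bsub>P\<^esub> else ?f (b a))" for a
  have b_in: "b a \<in> S" if "a \<in> obj G" "a \<noteq> v" for a
    using bij_betwE[OF b] that by blast
  have \<alpha>_closed: "\<alpha> a \<in> carrier P" if "a \<in> obj G" for a
    using that f_closed[OF b_in] by (simp add: \<alpha>_def)
  define \<chi> where
    "\<chi> x = \<alpha> (rng G x) \<otimes>\<^bsub>P\<^esub> (?\<beta> (to_base x) \<otimes>\<^bsub>P\<^esub> inv\<^bsub>P\<^esub> (\<alpha> (src G x)))" for x
  have \<chi>: "cocycle G P \<chi>"
    unfolding \<chi>_def by (rule cocycle_twisted[OF P \<alpha>_closed \<beta>])
  obtain \<Phi> where \<Phi>: "\<Phi> \<in> hom U P" "\<And>x. x \<in> mor G \<Longrightarrow> \<Phi> (\<rho> x) = \<chi> x"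
    using factor[OF \<chi>] by blast
  interpret \<Phi>: group_hom U P \<Phi>
    using \<Phi>(1) by unfold_locales

  define t where "t a = \<rho> (\<tau> a)" for a
  have t: "t a \<in> carrier U" if "a \<in> obj G" for a
    using cocycleD(1)[OF \<rho>] path_mor[OF that] by (simp add: t_def)
  have \<rho>_closed: "\<rho> x \<in> carrier U" if "x \<in> mor G" for x
    by (rule cocycleD(1)[OF \<rho> that])
  have I_mor: "x \<in> mor G" if "x \<in> carrier ?I" for x
    using that by (simp add: isotropy_group_def homset_def)
  define \<theta> where "\<theta> x = t v \<otimes>\<^bsub>U\<^esub> (\<rho> x \<otimes>\<^bsub>U\<^esub> inv\<^bsub>U\<^esub> (t v))" for x
  have \<theta>: "\<theta> \<in> hom ?I U"
  proof (rule homI)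
    fix x y assume xy: "x \<in> carrier ?I" "y \<in> carrier ?I"
    then have "\<rho> (x \<otimes>\<^bsub>?I\<^esub> y) = \<rho> x \<otimes>\<^bsub>U\<^esub> \<rho> y"
      using cocycleD(2)[OF \<rho>] by (simp add: isotropy_group_def homset_def)
    then show "\<theta> (x \<otimes>\<^bsub>?I\<^esub> y) = \<theta> x \<otimes>\<^bsub>U\<^esub> \<theta> y"
      using t[OF v] \<rho>_closed[OF I_mor] xy
      by (simp add: \<theta>_def U.m_assoc U.inv_cancel_left)
  qed (use t[OF v] \<rho>_closed[OF I_mor] in \<open>simp add: \<theta>_def\<close>)
  let ?b' = "inv_into (obj G - {v}) b"
  have b': "?b' s \<in> obj G" "?b' s \<noteq> v" "b (?b' s) = s" if "s \<in> S" for s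
    using bij_betwE[OF bij_betw_inv_into[OF b]] bij_betw_inv_into_right[OF b] that by auto
  have "(\<lambda>s. t (?b' s) \<otimes>\<^bsub>U\<^esub> inv\<^bsub>U\<^esub> (t v)) \<in> S \<rightarrow> carrier U"
    using t b' v by simp
  from ex1_implies_ex[OF free_group_universal[OF U this]]
  obtain \<phi> where \<phi>: "\<phi> \<in> hom ?F U"
    "\<And>s. s \<in> S \<Longrightarrow> \<phi> (free_gen S s) = t (?b' s) \<otimes>\<^bsub>U\<^esub> inv\<^bsub>U\<^esub> (t v)"
    by blast
  from ex1_implies_ex[OF free_product_universal[OF F I U \<phi>(1) \<theta>]]
  obtain \<Theta> where \<Theta>: "\<Theta> \<in> hom P U"
    "\<And>c. c \<in> carrier ?F \<Longrightarrow> \<Theta> (free_incl ?F ?I (Inl c)) = \<phi> c"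
    "\<And>x. x \<in> carrier ?I \<Longrightarrow> \<Theta> (?\<beta> x) = \<theta> x"
    unfolding P_def by blast
  interpret \<Theta>: group_hom P U \<Theta>
    using \<Theta>(1) by unfold_locales
  have \<Theta>_f: "\<Theta> (?f s) = t (?b' s) \<otimes>\<^bsub>U\<^esub> inv\<^bsub>U\<^esub> (t v)" if "s \<in> S" for s
    using \<Theta>(2)[OF free_gen_closed[OF that]] \<phi>(2)[OF that] by simp
  \<comment> \<open>At \<open>v\<close> both sides are trivial, so the formula holds at every object.\<close>
  have \<Theta>_\<alpha>: "\<Theta> (\<alpha> a) = t a \<otimes>\<^bsub>U\<^esub> inv\<^bsub>U\<^esub> (t v)" if "a \<in> obj G" for a
  proof (cases "a = v")
    case False
    then have "?b' (b a) = a" using bij_betw_inv_into_left[OF b] that by simp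
    then show ?thesis using False \<Theta>_f[OF b_in[OF that False]] by (simp add: \<alpha>_def)
  qed (use t[OF v] in \<open>simp add: \<alpha>_def\<close>)
  have \<beta>_closed: "?\<beta> x \<in> carrier P" if "x \<in> carrier ?I" for x
    by (rule hom_in_carrier[OF \<beta> that])

  have \<Theta>\<Phi>: "\<Theta> (\<Phi> y) = y" if "y \<in> carrier U" for y
  proof (rule endo[OF _ _ that])
    show "(\<lambda>y. \<Theta> (\<Phi> y)) \<in> hom U U"
      using hom_compose[OF \<Phi>(1) \<Theta>(1)] unfolding o_def .
    fix x assume x: "x \<in> mor G"
    have rs: "rng G x \<in> obj G" "src G x \<in> obj G" using rng_obj[OF x] src_obj[OF x] .
    have "\<rho> (to_base x) = inv\<^bsub>U\<^esub> (t (rng G x)) \<otimes>\<^bsub>U\<^esub> (\<rho> x \<otimes>\<^bsub>U\<^esub> t (src G x))"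
      using cocycle_to_base[OF U \<rho> x] by (simp add: t_def)
    then have "\<Theta> (\<chi> x) = \<rho> x"
      using x rs t[OF v] t[OF rs(1)] t[OF rs(2)] \<rho>_closed[OF x] \<alpha>_closed[OF rs(1)] \<alpha>_closed[OF rs(2)]
        to_base_closed[OF x] \<beta>_closed[OF to_base_closed[OF x]] \<Theta>(3)[OF to_base_closed[OF x]]
      by (simp add: \<chi>_def \<Theta>_\<alpha> \<theta>_def U.m_assoc U.inv_cancel_left U.inv_mult_group)
    then show "\<Theta> (\<Phi> (\<rho> x)) = \<rho> x" using \<Phi>(2)[OF x] by simp
  qed

  \<comment> \<open>The retraction sends every \<open>\<tau> a\<close> to the loop \<open>\<tau> u\<close>, so \<open>?z\<close> occurs in each \<open>\<Phi> (t a)\<close> and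
    cancels from the quotients \<open>t a \<cdot> (t v)\<^sup>-\<^sup>1\<close>.\<close>
  let ?z = "?\<beta> (\<tau> u)"
  have z: "?z \<in> carrier P" by (rule \<beta>_closed[OF path_base])
  have \<Phi>_t: "\<Phi> (t a) = \<alpha> a \<otimes>\<^bsub>P\<^esub> (?z \<otimes>\<^bsub>P\<^esub> inv\<^bsub>P\<^esub> (\<alpha> u))" if "a \<in> obj G" for a
    using path_mor[OF that] \<Phi>(2) to_base_path[OF that] by (simp add: t_def \<chi>_def)
  have \<alpha>v: "\<alpha> v = \<one>\<^bsub>P\<^esub>" by (simp add: \<alpha>_def)
  note cl = z \<alpha>_closed[OF base_obj]
  have f: "\<Phi> (\<Theta> (?f s)) = ?f s" if s: "s \<in> S" for s
  proof -
    have "\<alpha> (?b' s) = ?f s" using b'[OF s] by (simp add: \<alpha>_def)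
    then show ?thesis
      using \<Theta>_f[OF s] t[OF v] t[OF b'(1)[OF s]] \<Phi>_t[OF v] \<Phi>_t[OF b'(1)[OF s]] cl f_closed[OF s] \<alpha>v
      by (simp add: P.m_assoc P.inv_cancel_left P.inv_mult_group)
  qed
  have g: "\<Phi> (\<Theta> (?\<beta> x)) = ?\<beta> x" if x: "x \<in> carrier ?I" for x
  proof -
    have xm: "x \<in> mor G" "rng G x = u" "src G x = u"
      using x by (auto simp: isotropy_group_def homset_def)
    have bx: "?\<beta> (to_base x) \<in> carrier P" by (rule \<beta>_closed[OF to_base_closed[OF xm(1)]])
    have "?z \<otimes>\<^bsub>P\<^esub> ?\<beta> (to_base x) = ?\<beta> x \<otimes>\<^bsub>P\<^esub> ?z"
      using to_base_isotropy[OF x] hom_mult[OF \<beta>] path_base to_base_closed[OF xm(1)] x by metis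
    \<comment> \<open>Moving \<open>?z\<close> to the right turns the retract of \<open>x\<close> back into \<open>x\<close> itself.\<close>
    then have comm: "?z \<otimes>\<^bsub>P\<^esub> (?\<beta> (to_base x) \<otimes>\<^bsub>P\<^esub> y) = ?\<beta> x \<otimes>\<^bsub>P\<^esub> (?z \<otimes>\<^bsub>P\<^esub> y)"
      if "y \<in> carrier P" for y
      using that cl bx \<beta>_closed[OF x] by (simp add: P.m_assoc[symmetric])
    have "\<Phi> (\<rho> x) = \<alpha> u \<otimes>\<^bsub>P\<^esub> (?\<beta> (to_base x) \<otimes>\<^bsub>P\<^esub> inv\<^bsub>P\<^esub> (\<alpha> u))"
      using \<Phi>(2)[OF xm(1)] xm by (simp add: \<chi>_def)
    then show ?thesis
      using \<Theta>(3)[OF x] t[OF v] \<rho>_closed[OF xm(1)] \<Phi>_t[OF v] cl bx \<beta>_closed[OF x] \<alpha>v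
      by (simp add: \<theta>_def P.m_assoc P.inv_cancel_left P.inv_mult_group comm)
  qed
  have \<Phi>\<Theta>: "\<Phi> (\<Theta> y) = y" if "y \<in> carrier P" for y
  proof (rule hom_eq_on_generate)
    let ?Y = "(\<lambda>c. free_incl ?F ?I (Inl c)) ` (free_gen S ` S) \<union> ?\<beta> ` carrier ?I"
    show "group_hom P P (\<lambda>y. \<Phi> (\<Theta> y))"
      using hom_compose[OF \<Theta>(1) \<Phi>(1)] by unfold_locales (simp add: o_def)
    show "group_hom P P (\<lambda>y. y)"
      by unfold_locales (simp add: hom_def)
    show "?Y \<subseteq> carrier P" using f_closed \<beta>_closed by auto
    have "free_gen S ` S \<subseteq> carrier ?F" 
      by (rule image_subsetI) (rule free_gen_closed)
    from free_product_generated[OF F I this free_group_generated]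
    show "y \<in> generate P ?Y" using that unfolding P_def by (rule subsetD)
    fix x assume "x \<in> ?Y"
    then show "\<Phi> (\<Theta> x) = x"
    proof (elim UnE imageE)
      fix c s assume "x = free_incl ?F ?I (Inl c)" "c = free_gen S s" "s \<in> S"
      then show ?thesis by (simp only: f)
    next
      fix c assume "x = ?\<beta> c" "c \<in> carrier ?I"
      then show ?thesis by (simp only: g)
    qed
  qed
  have "group_isomorphisms U P \<Phi> \<Theta>"
    using \<Phi>(1) \<Theta>(1) \<Theta>\<Phi> \<Phi>\<Theta> by (simp add: group_isomorphisms_def)
  then show ?thesis
    by (rule is_isoI[OF group_isomorphisms_imp_iso])
qed

end


section \<open>Objects of the fundamental groupoid\<close>

text \<open>
  Exactly one morphism joins any two elements of \<open>V\<close>; the identity at \<open>a\<close> is the pair \<open>(a, a)\<close>.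
\<close>

definition pair_groupoid :: "'a set \<Rightarrow> ('a \<times> 'a) category" where
  "pair_groupoid V =
     \<lparr>mor = V \<times> V, rng = (\<lambda>p. (fst p, fst p)), src = (\<lambda>p. (snd p, snd p)),
      comp = (\<lambda>p q. (fst p, snd q))\<rparr>"

lemma groupoid_pair_groupoid: "groupoid (pair_groupoid V)"
proof unfold_locales
  fix x assume "x \<in> mor (pair_groupoid V)"
  then show "\<exists>y \<in> mor (pair_groupoid V). src (pair_groupoid V) y = rng (pair_groupoid V) x \<and>
      rng (pair_groupoid V) y = src (pair_groupoid V) x \<and>
      comp (pair_groupoid V) x y = rng (pair_groupoid V) x \<and>
      comp (pair_groupoid V) y x = src (pair_groupoid V) x"
    by (intro bexI[of _ "(snd x, fst x)"]) (auto simp: pair_groupoid_def)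
qed (auto simp: pair_groupoid_def obj_def)

text \<open>
  Sending a morphism to its pair of ends is a functor into the pair groupoid.  It factors through
  \<open>i\<close>, so \<open>i\<close> cannot identify two objects.
\<close>

lemma fundamental_groupoid_inj_on_obj:
  fixes C :: "'m category" and e :: "'m \<times> 'm \<Rightarrow> 'h"
  assumes C: "small_category C" and G: "fundamental_groupoid TYPE('h) C G i" and e: "inj e"
  shows "inj_on i (obj C)"
proof -
  interpret small_category C by (rule C)
  let ?K = "pair_groupoid (obj C)"
  have e_inj: "inj_on e (mor ?K)" using inj_on_subset[OF e subset_UNIV] .
  have ends: "is_functor C ?K (\<lambda>x. (rng C x, src C x))"
    using rng_obj src_obj rng_comp src_comp
    by (simp add: is_functor_def pair_groupoid_def) (simp add: obj_def)
  obtain F where F: "\<And>x. x \<in> mor C \<Longrightarrow> F (i x) = (rng C x, src C x)"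
    by (rule fundamental_groupoid_ex[OF G groupoid_pair_groupoid e_inj ends]) (rule that)
  have "fst (F (i s)) = s" if "s \<in> obj C" for s
    using that by (simp add: F obj_def)
  then show ?thesis by (rule inj_on_inverseI)
qed

definition full_subcategory :: "'a category \<Rightarrow> 'a set \<Rightarrow> 'a category" where
  "full_subcategory K V =
     \<lparr>mor = {x \<in> mor K. rng K x \<in> V \<and> src K x \<in> V}, rng = rng K, src = src K, comp = comp K\<rparr>"

lemma groupoid_full_subcategory:
  assumes "groupoid K"
  shows "groupoid (full_subcategory K V)"
proof -
  interpret groupoid K by fact
  have ids: "rng K x \<in> mor K" "rng K (rng K x) = rng K x" "src K (rng K x) = rng K x"
      "src K x \<in> mor K" "rng K (src K x) = src K x" "src K (src K x) = src K x"
    if "x \<in> mor K" for x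
    using rng_obj[OF that] src_obj[OF that] by (auto simp: obj_def)
  show ?thesis
  proof unfold_locales
    fix x assume "x \<in> mor (full_subcategory K V)"
    then have "x \<in> mor K" "rng K x \<in> V" "src K x \<in> V" by (auto simp: full_subcategory_def)
    then show "\<exists>y \<in> mor (full_subcategory K V).
        src (full_subcategory K V) y = rng (full_subcategory K V) x \<and>
        rng (full_subcategory K V) y = src (full_subcategory K V) x \<and>
        comp (full_subcategory K V) x y = rng (full_subcategory K V) x \<and>
        comp (full_subcategory K V) y x = src (full_subcategory K V) x"
      using inv_mor[of x] by (intro bexI[of _ "inv_mor x"]) (auto simp: full_subcategory_def)
  qed (auto simp: full_subcategory_def obj_def ids comp_mor rng_comp src_comp rng_left_id
      src_right_id comp_assoc)
qed

text \<open>
  Let \<open>F\<close> be the lift of \<open>i\<close> to the full subcategory on the image of the objects.  Viewed as an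
  endofunctor of \<open>G\<close> it agrees with the identity on the image of \<open>i\<close>, hence everywhere, so every
  object lies in that subcategory.
\<close>

lemma fundamental_groupoid_obj:
  fixes G :: "'g category" and e :: "'g \<Rightarrow> 'h"
  assumes C: "small_category C" and G: "fundamental_groupoid TYPE('h) C G i" and e: "inj e"
  shows "obj G = i ` obj C"
proof
  interpret small_category C by (rule C)
  have iG: "groupoid G" "is_functor C G i" using G by (auto simp: fundamental_groupoid_def)
  let ?K = "full_subcategory G (i ` obj C)"
  have e_inj: "inj_on e (mor ?K)" "inj_on e (mor G)" using inj_on_subset[OF e subset_UNIV] by auto
  have iK: "is_functor C ?K i"
    using is_functorD[OF iG(2)] is_functor_comp_mor[OF iG(2)] rng_obj src_obj
    by (simp add: is_functor_def full_subcategory_def)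
  obtain F where F: "is_functor G ?K F" "\<And>x. x \<in> mor C \<Longrightarrow> F (i x) = i x"
    by (rule fundamental_groupoid_ex[OF G groupoid_full_subcategory[OF iG(1)]
          e_inj(1) iK]) (rule that)
  have "is_functor ?K G (\<lambda>x. x)" by (simp add: is_functor_def full_subcategory_def)
  then have FG: "is_functor G G F" using is_functor_compose[OF F(1)] by blast
  have F_id: "F y = y" if "y \<in> mor G" for y
    using fundamental_groupoid_eq[OF G iG(1) e_inj(2) FG is_functor_id F(2) that] .
  show "obj G \<subseteq> i ` obj C"
  proof
    fix a assume a: "a \<in> obj G"
    then have "a \<in> mor G" "rng G a = a" by (auto simp: obj_def)
    then show "a \<in> i ` obj C"
      using is_functorD(1)[OF F(1), of a] F_id by (simp add: full_subcategory_def)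
  qed
  show "i ` obj C \<subseteq> obj G" using is_functor_obj[OF iG(2)] by blast
qed

text \<open>
  Being joined by a morphism of the groupoid is an equivalence relation on the objects of \<open>C\<close>, as
  morphisms can be inverted and composed.  It contains the generators of the relation that defines
  connectedness.
\<close>

lemma connected_category_homset:
  assumes "connected_category C" "groupoid G" "is_functor C G i" "s \<in> obj C" "t \<in> obj C"
  shows "homset G (i s) (i t) \<noteq> {}"
proof -
  interpret groupoid G by fact
  let ?E = "{(s, t) \<in> obj C \<times> obj C. homset G (i s) (i t) \<noteq> {}}"
  have "equiv (obj C) ?E"
  proof (rule equivI)
    show "refl_on (obj C) ?E"
      using is_functor_obj[OF assms(3)] by (fastforce intro: refl_onI simp: homset_def obj_def)
    show "sym ?E"
    proof (rule symI, clarsimp)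
      fix s t assume "homset G (i s) (i t) \<noteq> {}" "homset G (i t) (i s) = {}"
      moreover have "inv_mor x \<in> homset G (i t) (i s)" if "x \<in> homset G (i s) (i t)" for x
        using that inv_mor[of x] by (simp add: homset_def)
      ultimately show False by blast
    qed
    show "trans ?E"
    proof (rule transI, clarsimp)
      fix s t r
      assume "homset G (i s) (i t) \<noteq> {}" "homset G (i t) (i r) \<noteq> {}" "homset G (i s) (i r) = {}"
      moreover have "comp G x y \<in> homset G (i s) (i r)"
        if "x \<in> homset G (i s) (i t)" "y \<in> homset G (i t) (i r)" for x y
        using that comp_mor rng_comp src_comp by (simp add: homset_def)
      ultimately show False by blast
    qed
  qed auto
  moreover have "{(v, w) \<in> obj C \<times> obj C. homset C v w \<noteq> {}} \<subseteq> ?E"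
    using is_functor_homset[OF assms(3)] by fast
  ultimately have "obj C \<times> obj C \<subseteq> ?E"
    using assms(1) unfolding connected_category_def by blast
  then show ?thesis using assms(4,5) by blast
qed


section \<open>The universal group of a connected category\<close>

text \<open>
  Objects in \<open>S\<close> serve as letters for the free generators, and elements of the isotropy group as
  letters for themselves.  All other letters denote the unit.  The elements \<open>m\<close> and \<open>u\<close>
  supply the two distinct letters that encode the signs.
\<close>

lemma free_product_inj_on_universe:
  fixes S :: "'m set" and I :: "'g monoid" and m :: 'm and u :: 'u
  assumes I: "group I"
  obtains e :: "(('m \<times> bool) list set + 'g) list set \<Rightarrow> ('m, 'u, 'g) universe"
  where "inj_on e (carrier (free_product (free_group S) I))"
proof -
  let ?F = "free_group S"
  let ?P = "free_product ?F I"
  interpret P: group ?P by (rule group_free_product[OF group_free_group I])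
  let ?f = "\<lambda>s. free_incl ?F I (Inl (free_gen S s))"
  let ?\<beta> = "\<lambda>g. free_incl ?F I (Inr g)"
  define \<gamma> :: "'m + 'u + 'g \<Rightarrow> _" where
    "\<gamma> = case_sum (\<lambda>s. if s \<in> S then ?f s else \<one>\<^bsub>?P\<^esub>)
      (case_sum (\<lambda>_. \<one>\<^bsub>?P\<^esub>) (\<lambda>g. if g \<in> carrier I then ?\<beta> g else \<one>\<^bsub>?P\<^esub>))"
  have closed: "\<gamma> c \<in> carrier ?P" for c
    by (auto simp: \<gamma>_def free_gen_closed InlI InrI intro!: free_incl_closed split: sum.split)
  have "?f s \<in> range \<gamma>" if "s \<in> S" for s
    using that by (intro range_eqI[of _ _ "Inl s"]) (simp add: \<gamma>_def)
  moreover have "?\<beta> g \<in> range \<gamma>" if "g \<in> carrier I" for g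
    using that by (intro range_eqI[of _ _ "Inr (Inr g)"]) (simp add: \<gamma>_def)
  ultimately have gens: "(\<lambda>c. free_incl ?F I (Inl c)) ` (free_gen S ` S) \<union> ?\<beta> ` carrier I
      \<subseteq> range \<gamma>"
    by (intro Un_least image_subsetI) (elim imageE, simp, simp)
  have "free_gen S ` S \<subseteq> carrier ?F"
    by (rule image_subsetI) (rule free_gen_closed)
  from free_product_generated[OF group_free_group I this free_group_generated]
  have "carrier ?P \<subseteq> generate ?P (range \<gamma>)"
    using P.mono_generate[OF gens] by (rule subset_trans)
  then show thesis
    by (rule P.generated_inj_on_words[where p = "Inl m" and q = "Inr (Inl u)", OF closed])
      (simp_all add: that)
qed

theorem corollary6p9:
  fixes C :: "'m category" and U :: "'u monoid" and G :: "'g category"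
    and j :: "'m \<Rightarrow> 'u" and i :: "'m \<Rightarrow> 'g" and v w :: 'm
  assumes "small_category C"
    and "connected_category C"
    and "universal_group TYPE(('m, 'u, 'g) universe) C U j"
    and "fundamental_groupoid TYPE(('m, 'u, 'g) universe) C G i"
    and "v \<in> obj C"
    and "w \<in> obj C"
  shows "U \<cong> free_product (free_group (obj C - {v})) (isotropy_group G (i w))"
proof -
  note UP = assms(3) and GP = assms(4)
  let ?P = "free_product (free_group (obj C - {v})) (isotropy_group G (i w))"
  have G: "groupoid G" and i: "is_functor C G i" using GP by (auto simp: fundamental_groupoid_def)
  interpret G: groupoid G by (rule G)
  have U: "group U" and j: "cocycle C U j" using UP by (auto simp: universal_group_def)
  have iw: "i w \<in> obj G" using is_functor_obj[OF i assms(6)] .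
  have I: "group (isotropy_group G (i w))" by (rule G.group_isotropy_group[OF iw])
  have P: "group ?P" by (rule group_free_product[OF group_free_group I])
  obtain eP :: "_ \<Rightarrow> ('m, 'u, 'g) universe" where eP: "inj_on eP (carrier ?P)"
    by (rule free_product_inj_on_universe[OF I])
  define eU :: "'u \<Rightarrow> ('m, 'u, 'g) universe" where "eU x = [Inr (Inl x)]" for x
  have eU: "inj_on eU (carrier U)" by (simp add: inj_on_def eU_def)

  have inj: "inj_on i (obj C)"
    by (rule fundamental_groupoid_inj_on_obj[OF assms(1) GP, of "\<lambda>p. [Inl (fst p), Inl (snd p)]"])
      (auto simp: inj_def)
  have obj: "obj G = i ` obj C"
    by (rule fundamental_groupoid_obj[OF assms(1) GP, of "\<lambda>x. [Inr (Inr x)]"]) (simp add: inj_def)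
  have "\<exists>x. x \<in> homset G a (i w)" if "a \<in> obj G" for a
    using that connected_category_homset[OF assms(2) G i _ assms(6)] unfolding obj by blast
  then obtain \<tau> where \<tau>: "\<And>a. a \<in> obj G \<Longrightarrow> \<tau> a \<in> homset G a (i w)" by metis
  interpret based_groupoid G "i w" \<tau>
    by unfold_locales (use iw \<tau> in auto)

  have eU_mor: "inj_on eU (mor (group_category U))" using eU by (simp add: group_category_def)
  obtain \<rho> where "is_functor G (group_category U) \<rho>"
    and \<rho>j: "\<And>x. x \<in> mor C \<Longrightarrow> \<rho> (i x) = j x"
    by (rule fundamental_groupoid_ex[OF GP groupoid_group_category[OF U]
          eU_mor j[unfolded cocycle_def]]) (rule that)
  then have \<rho>: "cocycle G U \<rho>" by (simp add: cocycle_def)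
  show ?thesis
  proof (rule universal_group_iso_free_product[OF _ _ U \<rho>])
    show "i v \<in> obj G" using is_functor_obj[OF i assms(5)] .
    have "bij_betw i (obj C) (obj G)" using inj obj by (simp add: bij_betw_def)
    then have "bij_betw i (obj C - {v}) (obj G - {i v})"
      using assms(5) by (intro bij_betw_DiffI) (auto simp: bij_betw_def)
    then show "bij_betw (inv_into (obj C - {v}) i) (obj G - {i v}) (obj C - {v})"
      by (rule bij_betw_inv_into)
  next
    fix \<chi> assume \<chi>: "cocycle G ?P \<chi>"
    obtain \<Phi> where \<Phi>: "\<Phi> \<in> hom U ?P" "\<And>x. x \<in> mor C \<Longrightarrow> \<Phi> (j x) = \<chi> (i x)"
    by (rule universal_group_ex[OF UP P eP cocycle_functor[OF i \<chi>]]) (rule that)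
    \<comment> \<open>Both sides are functors on \<open>G\<close> that agree on the image of \<open>C\<close>.\<close>
    have "\<Phi> (\<rho> x) = \<chi> x" if "x \<in> mor G" for x
    proof (rule fundamental_groupoid_eq[OF GP groupoid_group_category[OF P], of eP])
      show "inj_on eP (mor (group_category ?P))" using eP by (simp add: group_category_def)
      show "is_functor G (group_category ?P) (\<lambda>x. \<Phi> (\<rho> x))"
        using cocycle_hom[OF U P \<Phi>(1) \<rho>] by (simp add: cocycle_def)
      show "is_functor G (group_category ?P) \<chi>" using \<chi> by (simp add: cocycle_def)
    qed (use \<Phi>(2) \<rho>j that in simp_all)
    then show "\<exists>\<Phi> \<in> hom U ?P. \<forall>x \<in> mor G. \<Phi> (\<rho> x) = \<chi> x" using \<Phi>(1) by blast
  next
    fix h y assume h: "h \<in> hom U U" "\<And>x. x \<in> mor G \<Longrightarrow> h (\<rho> x) = \<rho> x" and y: "y \<in> carrier U"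
    show "h y = y"
    proof (rule universal_group_eq[OF UP U eU h(1) _ _ y])
      show "(\<lambda>y. y) \<in> hom U U" by (simp add: hom_def)
      show "h (j x) = j x" if "x \<in> mor C" for x
        using h(2)[of "i x"] is_functorD(1)[OF i that] \<rho>j[OF that] by simp
    qed
  qed
qed

end
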